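(* Let $r\in\{3,4\}$, let $m$ be a positive integer, and let $G$ be a graph with exactly $m$ edges, no isolated vertices, and containing no subgraph isomorphic to $\theta_{1,2,r}$. Let $\lambda(G)$ denote the spectral radius of $G$. (i) If $r=3$ and $m\geqslant 8$, then $\lambda(G)\leqslant \frac{1+\sqrt{4m-3}}{2}$, with equality if and only if $G\cong S_{\frac{m+3}{2},2}$. (ii) If $r=4$ and $m\geqslant 22$, then $\lambda(G)\leqslant \frac{1+\sqrt{4m-3}}{2}$, with equality if and only if $G\cong S_{\frac{m+3}{2},2}$.
   Context: All graphs are finite and simple. The spectral radius $\lambda(G)$ of a graph is the largest modulus of the eigenvalues of its adjacency matrix. The theta graph $\theta_{p,q,r}$ is the graph obtained by connecting two distinct vertices with three internally disjoint paths of lengths $p,q,r$ (length = number of edges). For graphs $G,H$, the join $G\vee H$ is obtained from the disjoint union $G\cup H$ by adding all edges between $V(G)$ and $V(H)$. The complete split graph is $S_{n,k}:=K_k\vee (n-k)K_1$ (so $S_{\frac{m+3}{2},2}$ has $m$ edges and exists only when $m$ is odd). *)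

theory Defs
  imports "Jordan_Normal_Form.Spectral_Radius"
begin

type_synonym 'a ugraph = "'a set \<times> 'a set set"

abbreviation verts :: "'a ugraph \<Rightarrow> 'a set" where
  "verts G \<equiv> fst G"

abbreviation edges :: "'a ugraph \<Rightarrow> 'a set set" where
  "edges G \<equiv> snd G"

definition simple_graph :: "'a ugraph \<Rightarrow> bool" where
  "simple_graph G \<longleftrightarrow> finite (verts G) \<and> (\<forall>e\<in>edges G. e \<subseteq> verts G \<and> card e = 2)"

definition no_isolated_vertices :: "'a ugraph \<Rightarrow> bool" where
  "no_isolated_vertices G \<longleftrightarrow> (\<forall>v\<in>verts G. \<exists>e\<in>edges G. v \<in> e)"

definition subgraph_of :: "'a ugraph \<Rightarrow> 'a ugraph \<Rightarrow> bool" where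
  "subgraph_of H G \<longleftrightarrow> simple_graph H \<and> verts H \<subseteq> verts G \<and> edges H \<subseteq> edges G"

definition graph_iso :: "'a ugraph \<Rightarrow> 'b ugraph \<Rightarrow> bool" (infix "\<cong>\<^sub>g" 50) where
  "G \<cong>\<^sub>g H \<longleftrightarrow> (\<exists>f. bij_betw f (verts G) (verts H) \<and>
     (\<forall>u\<in>verts G. \<forall>v\<in>verts G. {u, v} \<in> edges G \<longleftrightarrow> {f u, f v} \<in> edges H))"

definition contains_copy :: "'a ugraph \<Rightarrow> 'b ugraph \<Rightarrow> bool" where
  "contains_copy G F \<longleftrightarrow> (\<exists>H. subgraph_of H G \<and> H \<cong>\<^sub>g F)"

text \<open>The rows and columns of the adjacency matrix follow an arbitrary but fixed enumeration of the
  vertices; another enumeration gives a permutation-similar matrix, hence the same eigenvalues.\<close>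

definition vertex_list :: "'a ugraph \<Rightarrow> 'a list" where
  "vertex_list G = (SOME vs. distinct vs \<and> set vs = verts G)"

definition adjacency_matrix :: "'a ugraph \<Rightarrow> complex mat" where
  "adjacency_matrix G = (let vs = vertex_list G; n = length vs in
     mat n n (\<lambda>(i, j). if {vs ! i, vs ! j} \<in> edges G then 1 else 0))"

definition graph_spectral_radius :: "'a ugraph \<Rightarrow> real" where
  "graph_spectral_radius G = spectral_radius (adjacency_matrix G)"

datatype theta_vertex = Source | Sink | Inner nat nat

text \<open>The \<open>i\<close>-th path, of length \<open>l \<ge> 1\<close>, as the list of its \<open>l + 1\<close> vertices.
  The path index \<open>i\<close> keeps inner vertices of different paths distinct.\<close>

definition theta_path :: "nat \<Rightarrow> nat \<Rightarrow> theta_vertex list" where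
  "theta_path i l = Source # map (Inner i) [1..<l] @ [Sink]"

definition path_edges :: "'a list \<Rightarrow> 'a set set" where
  "path_edges xs = {{xs ! k, xs ! Suc k} | k. Suc k < length xs}"

text \<open>As for the usual notation, this is meaningful for positive lengths of which at most one
  equals 1 (parallel edges would be identified otherwise).\<close>

definition theta_graph :: "nat \<Rightarrow> nat \<Rightarrow> nat \<Rightarrow> theta_vertex ugraph" where
  "theta_graph p q r =
     (set (theta_path 0 p) \<union> set (theta_path 1 q) \<union> set (theta_path 2 r),
      path_edges (theta_path 0 p) \<union> path_edges (theta_path 1 q) \<union> path_edges (theta_path 2 r))"

definition complete_graph :: "nat \<Rightarrow> nat ugraph" where
  "complete_graph n = ({..<n}, {{i, j} | i j. i < n \<and> j < n \<and> i \<noteq> j})"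

definition graph_copies :: "nat \<Rightarrow> 'a ugraph \<Rightarrow> (nat \<times> 'a) ugraph" where
  "graph_copies t G = ({..<t} \<times> verts G, {Pair i ` e | i e. i < t \<and> e \<in> edges G})"

definition graph_join :: "'a ugraph \<Rightarrow> 'b ugraph \<Rightarrow> ('a + 'b) ugraph" where
  "graph_join G H =
     (verts G <+> verts H,
      image Inl ` edges G \<union> image Inr ` edges H \<union>
      {{Inl u, Inr v} | u v. u \<in> verts G \<and> v \<in> verts H})"

definition complete_split_graph :: "nat \<Rightarrow> nat \<Rightarrow> (nat + nat \<times> nat) ugraph" where
  "complete_split_graph n k =
     graph_join (complete_graph k) (graph_copies (n - k) (complete_graph 1))"

end

theory Submission
  imports Defs "HOL-Analysis.Function_Topology"
begin

text \<open>
  Let \<open>x\<close> be a nonnegative eigenvector for \<open>\<lambda>\<close>, scaled to have maximum \<open>1 = x(u0)\<close>, let \<open>N\<close> be the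
  neighbourhood of \<open>u0\<close> and \<open>W\<close> the set of the remaining vertices.  If \<open>\<lambda>\<^sup>2 - \<lambda> \<ge> m - 1\<close>, counting walks of
  length two from \<open>u0\<close> gives
  \<open>\<Sum>H. (e(H) - \<Sum>u\<in>H. (d\<^sub>H(u) - 1) x(u)) + e(W) + \<Sum>w\<in>W. d\<^sub>N(w) (1 - x(w)) \<le> 1\<close>,
  where \<open>H\<close> ranges over the components of \<open>G[N]\<close>.  Isolated vertices contribute \<open>x(u) > 0\<close> and trees at
  least \<open>1\<close>.  Since \<open>G\<close> has no \<open>\<theta>(1,2,r)\<close>, there is no path on \<open>r + 1\<close> vertices in \<open>G[N]\<close>, so a component with a
  cycle has at most four vertices or is a triangle with pendant edges at one vertex.  Moreover the outer
  neighbours of such a component are so restricted that, together with their own contributions, they would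
  violate the bound.  Hence \<open>G[N]\<close> is a single tree and equality holds throughout, which forces
  \<open>W = {}\<close> and \<open>G[N]\<close> to be a star, so \<open>G\<close> is a book of triangles, i.e. \<open>K\<^sub>2 \<or> (n - 2) K\<^sub>1\<close>.
\<close>

section \<open>The Perron vector\<close>

text \<open>The bound (1 + sqrt(4m - 3))/2 is the larger root of t^2 - t = m - 1, so a spectral
  radius at or above it leaves a total charge of at most 1, exactly what one tree uses up. The
  obstacle is a component with a cycle: its own charge can vanish or be negative (for a triangle it
  is 3 minus the sum of x), so charge must come from outside. Where x is close to 1 on a component
  of small degree, the eigenvalue equation demands much weight on outer vertices. These see few
  vertices of the component, so they either have x noticeably below 1 or have edges within W, and
  both are charged. For r = 4, m >= 22 gives lambda > 5, enough to settle each cyclic component on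
  its own. For r = 3, m >= 8 gives little more than lambda > 3, and a triangle must be weighed
  against everything else: the rest of N, the edges inside W and the shortfall of its outer
  neighbours.\<close>

lemma nonneg_symmetric_form_eigenvector:
  fixes a :: "'a \<Rightarrow> 'a \<Rightarrow> real"
  assumes fin: "finite V" and ne: "V \<noteq> {}"
    and nonneg: "\<And>u v. 0 \<le> a u v" and sym: "\<And>u v. a u v = a v u"
  obtains x M where "\<And>v. v \<in> V \<Longrightarrow> 0 \<le> x v" and "(\<Sum>v\<in>V. (x v)\<^sup>2) = 1"
    and "\<And>v. v \<in> V \<Longrightarrow> (\<Sum>u\<in>V. a v u * x u) = M * x v"
    and "\<And>y. (\<Sum>v\<in>V. \<Sum>u\<in>V. a v u * y v * y u) \<le> M * (\<Sum>v\<in>V. (y v)\<^sup>2)"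
proof -
  define Q where "Q y = (\<Sum>v\<in>V. \<Sum>u\<in>V. a v u * y v * y u)" for y :: "'a \<Rightarrow> real"
  define n2 where "n2 y = (\<Sum>v\<in>V. (y v)\<^sup>2)" for y :: "'a \<Rightarrow> real"
  \<comment> \<open>Coordinates off V are pinned to 0, so the set is compact in the product topology
    although the type may be infinite.\<close>
  define B where "B = PiE UNIV (\<lambda>v. if v \<in> V then {0..1::real} else {0})"
  define K where "K = {y \<in> B. n2 y = 1}"
  have cQ: "continuous_on UNIV Q" unfolding Q_def
    by (intro continuous_intros continuous_on_product_coordinates)
  have cn: "continuous_on UNIV n2" unfolding n2_def
    by (intro continuous_intros continuous_on_product_coordinates)
  have "compactin (product_topology (\<lambda>_. euclidean) UNIV) B"
    unfolding B_def compactin_PiE by simp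
  then have cB: "compact B"
    by (simp add: euclidean_product_topology)
  have "closed {y. n2 y = 1}"
    using cn by (intro closed_Collect_eq) (auto intro: continuous_intros)
  then have cK: "compact K"
    using cB by (simp add: K_def Collect_conj_eq compact_Int_closed)
  obtain v0 where v0: "v0 \<in> V" using ne by auto
  have "(\<lambda>v. if v = v0 then 1 else 0) \<in> K"
    using v0 fin by (auto simp: K_def B_def n2_def if_distrib[of "\<lambda>t. t\<^sup>2"] sum.delta cong: if_cong)
  then have "K \<noteq> {}" by auto
  then obtain x where x: "x \<in> K" and max: "\<And>y. y \<in> K \<Longrightarrow> Q y \<le> Q x"
    using continuous_attains_sup[OF cK, of Q] cQ continuous_on_subset by blast
  have x0: "0 \<le> x v" if "v \<in> V" for v
    using x that by (auto simp: K_def B_def dest!: PiE_mem[where x = v])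
  have n2x: "n2 x = 1" using x by (simp add: K_def)
  define M where "M = Q x"
  have bound: "Q y \<le> M * n2 y" for y
  proof (cases "n2 y = 0")
    case True
    then have "\<forall>v\<in>V. y v = 0"
      using fin by (auto simp: n2_def sum_nonneg_eq_0_iff)
    then show ?thesis using True by (simp add: Q_def)
  next
    case False
    have "0 \<le> n2 y" by (simp add: n2_def sum_nonneg)
    with False have pos: "0 < n2 y" by simp
    \<comment> \<open>Normalised absolute values: as \<open>a\<close> is nonnegative, the maximum
      over nonnegative unit vectors bounds the form everywhere.\<close>
    define z where "z v = (if v \<in> V then \<bar>y v\<bar> / sqrt (n2 y) else 0)" for v
    have n2z: "n2 z = 1"
    proof -
      have "n2 z = (\<Sum>v\<in>V. (y v)\<^sup>2 / n2 y)"
        unfolding n2_def[of z] z_def using pos by (intro sum.cong) (auto simp: power_divide)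
      also have "\<dots> = n2 y / n2 y" by (subst (2) n2_def) (rule sum_divide_distrib[symmetric])
      finally show ?thesis using pos by simp
    qed
    have "z v \<le> 1" if "v \<in> V" for v
    proof -
      have "(z v)\<^sup>2 \<le> n2 z" unfolding n2_def
        using fin that by (intro member_le_sum) auto
      then show ?thesis using n2z by (simp add: abs_square_le_1)
    qed
    then have "z \<in> K" using n2z pos by (auto simp: K_def B_def PiE_def z_def)
    then have "Q z \<le> M" using max by (simp add: M_def)
    moreover have "Q y \<le> n2 y * Q z"
    proof -
      have "Q y \<le> (\<Sum>v\<in>V. \<Sum>u\<in>V. a v u * \<bar>y v\<bar> * \<bar>y u\<bar>)"
        unfolding Q_def using nonneg by (intro sum_mono) (metis abs_ge_self abs_mult abs_of_nonneg)
      also have "\<dots> = (\<Sum>v\<in>V. \<Sum>u\<in>V. n2 y * (a v u * z v * z u))"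
        using pos by (intro sum.cong) (auto simp: z_def)
      finally show ?thesis by (simp add: Q_def sum_distrib_left)
    qed
    ultimately show ?thesis using pos by (metis mult.commute mult_left_mono order.trans less_imp_le)
  qed
  have eig: "(\<Sum>u\<in>V. a v u * x u) = M * x v" if v: "v \<in> V" for v
  proof (rule ccontr)
    assume neq: "(\<Sum>u\<in>V. a v u * x u) \<noteq> M * x v"
    define c where "c = (\<Sum>u\<in>V. a v u * x u) - M * x v"
    define \<delta> where "\<delta> u = (if u = v then 1 else 0 :: real)" for u
    have s\<delta>: "(\<Sum>u\<in>V. f u * \<delta> u) = f v" for f
      using fin v by (simp add: \<delta>_def if_distrib cong: if_cong)
    \<comment> \<open>First-order condition at the single coordinate v: a linear term in t bounded
      by a quadratic one, for t of both signs, forces c = 0.\<close>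
    have key: "2 * t * c \<le> t\<^sup>2 * (M - a v v)" for t
    proof -
      have "Q (\<lambda>u. x u + t * \<delta> u) = Q x + t * (\<Sum>w\<in>V. \<Sum>u\<in>V. a w u * x w * \<delta> u)
          + t * (\<Sum>w\<in>V. (\<Sum>u\<in>V. a w u * x u) * \<delta> w) + t\<^sup>2 * (\<Sum>w\<in>V. (\<Sum>u\<in>V. a w u * \<delta> u) * \<delta> w)"
        unfolding Q_def sum_distrib_left sum_distrib_right sum.distrib[symmetric]
        by (intro sum.cong refl) (simp add: algebra_simps power2_eq_square)
      also have "\<dots> = M + t * (\<Sum>w\<in>V. a w v * x w) + t * (\<Sum>u\<in>V. a v u * x u) + t\<^sup>2 * a v v"
        by (simp only: s\<delta> M_def)
      also have "\<dots> = M + 2 * t * (\<Sum>u\<in>V. a v u * x u) + t\<^sup>2 * a v v"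
        using sym by simp
      finally have 1: "Q (\<lambda>u. x u + t * \<delta> u) = M + 2 * t * (\<Sum>u\<in>V. a v u * x u) + t\<^sup>2 * a v v" .
      have "n2 (\<lambda>u. x u + t * \<delta> u) = (\<Sum>u\<in>V. (x u)\<^sup>2 + 2 * t * (x u * \<delta> u) + t\<^sup>2 * (\<delta> u * \<delta> u))"
        unfolding n2_def by (intro sum.cong refl) (simp add: algebra_simps power2_eq_square)
      also have "\<dots> = n2 x + 2 * t * (\<Sum>u\<in>V. x u * \<delta> u) + t\<^sup>2 * (\<Sum>u\<in>V. \<delta> u * \<delta> u)"
        by (simp add: n2_def sum.distrib sum_distrib_left)
      also have "\<dots> = 1 + 2 * t * x v + t\<^sup>2"
        by (simp only: s\<delta> n2x) (simp add: \<delta>_def)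
      finally show ?thesis
        using bound[of "\<lambda>u. x u + t * \<delta> u"] 1 by (simp add: c_def algebra_simps)
    qed
    have c0: "c \<noteq> 0" using neq by (simp add: c_def)
    \<comment> \<open>\<open>L\<close> is positive and exceeds the quadratic coefficient, so at t =
      c / L the linear term wins.\<close>
    define L where "L = \<bar>M - a v v\<bar> + 1"
    have L: "L > 0" "M - a v v < L" by (auto simp: L_def)
    have "2 * (c / L) * c \<le> (c / L)\<^sup>2 * (M - a v v)" by (rule key)
    also have "\<dots> \<le> (c / L)\<^sup>2 * L" using L by (intro mult_left_mono) auto
    also have "\<dots> = c\<^sup>2 / L" using L by (simp add: power2_eq_square)
    finally have "c\<^sup>2 / L \<le> 0" by (simp add: power2_eq_square)
    then show False using L c0 by (simp add: divide_le_0_iff)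
  qed
  show ?thesis
    by (rule that[OF x0 _ eig]) (use n2x bound in \<open>auto simp: Q_def n2_def\<close>)
qed

definition nbrs :: "'a ugraph \<Rightarrow> 'a \<Rightarrow> 'a set" where
  "nbrs G v = {u. {v, u} \<in> edges G}"

lemma nbrs_sym: "u \<in> nbrs G v \<longleftrightarrow> v \<in> nbrs G u"
  by (simp add: nbrs_def insert_commute)

lemma nbrs_subset: "simple_graph G \<Longrightarrow> nbrs G v \<subseteq> verts G"
  by (auto simp: nbrs_def simple_graph_def)

lemma nbrs_irrefl: "simple_graph G \<Longrightarrow> v \<notin> nbrs G v"
  by (auto simp: nbrs_def simple_graph_def)

text \<open>The maximum M of the form is an eigenvalue, hence at most the spectral radius. Putting
  the entrywise modulus of a complex eigenvector of largest eigenvalue into the form gives the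
  reverse inequality.\<close>

lemma perron_vector:
  assumes G: "simple_graph G" and ne: "verts G \<noteq> {}"
  obtains x :: "'a \<Rightarrow> real" where "\<And>v. v \<in> verts G \<Longrightarrow> 0 \<le> x v"
    and "\<exists>v\<in>verts G. 0 < x v"
    and "\<And>v. v \<in> verts G \<Longrightarrow> graph_spectral_radius G * x v = (\<Sum>u\<in>nbrs G v. x u)"
proof -
  define V where "V = verts G"
  have fin: "finite V" using G by (simp add: simple_graph_def V_def)
  define a where "a u v = (if {u, v} \<in> edges G then 1 else 0 :: real)" for u v
  obtain x M where x0: "\<And>v. v \<in> V \<Longrightarrow> 0 \<le> x v" and n2: "(\<Sum>v\<in>V. (x v)\<^sup>2) = 1"
    and eig: "\<And>v. v \<in> V \<Longrightarrow> (\<Sum>u\<in>V. a v u * x u) = M * x v"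
    and bd: "\<And>y. (\<Sum>v\<in>V. \<Sum>u\<in>V. a v u * y v * y u) \<le> M * (\<Sum>v\<in>V. (y v)\<^sup>2)"
  proof (rule nonneg_symmetric_form_eigenvector[of V a])
    show "finite V" "V \<noteq> {}" using fin ne by (simp_all add: V_def)
    show "0 \<le> a u v" "a u v = a v u" for u v by (simp_all add: a_def insert_commute)
  qed (rule that)
  define vs where "vs = vertex_list G"
  have "distinct vs \<and> set vs = verts G"
    unfolding vs_def vertex_list_def
    by (rule someI_ex) (use finite_distinct_list[OF fin] in \<open>auto simp: V_def\<close>)
  then have vs: "distinct vs" "set vs = V" by (auto simp: V_def)
  define n where "n = length vs"
  have bij: "bij_betw (\<lambda>i. vs ! i) {..<n} V"
    using bij_betw_nth[OF vs(1), of "{..<n}"] vs(2) by (simp add: n_def)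
  have n: "n > 0" using ne vs by (auto simp: n_def V_def)
  define A where "A = adjacency_matrix G"
  have A_def': "A = mat n n (\<lambda>(i, j). of_real (a (vs ! i) (vs ! j)))"
    unfolding A_def adjacency_matrix_def by (auto simp: Let_def vs_def n_def a_def)
  have A: "A \<in> carrier_mat n n" by (simp add: A_def')
  have mult: "(A *\<^sub>v w) $ i = (\<Sum>j<n. of_real (a (vs ! i) (vs ! j)) * w $ j)"
    if "w \<in> carrier_vec n" "i < n" for w i
    using that A by (simp add: A_def' scalar_prod_def atLeast0LessThan)
  have reindex: "(\<Sum>j<n. f (vs ! j)) = (\<Sum>v\<in>V. f v)" for f :: "'a \<Rightarrow> 'b::comm_monoid_add"
    by (rule sum.reindex_bij_betw[OF bij])
  define \<rho> where "\<rho> = graph_spectral_radius G"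
  have \<rho>: "\<rho> = spectral_radius A" by (simp add: \<rho>_def graph_spectral_radius_def A_def)
  have "M \<le> \<rho>"
  proof -
    define w where "w = vec n (\<lambda>i. complex_of_real (x (vs ! i)))"
    have w: "w \<in> carrier_vec n" by (simp add: w_def)
    have "A *\<^sub>v w = of_real M \<cdot>\<^sub>v w"
    proof (rule eq_vecI)
      fix i assume "i < dim_vec (of_real M \<cdot>\<^sub>v w)"
      then have i: "i < n" by (simp add: w_def)
      have "(A *\<^sub>v w) $ i = of_real (\<Sum>j<n. a (vs ! i) (vs ! j) * x (vs ! j))"
        using mult[OF w i] by (simp add: w_def)
      also have "(\<Sum>j<n. a (vs ! i) (vs ! j) * x (vs ! j)) = M * x (vs ! i)"
        using reindex[of "\<lambda>u. a (vs ! i) u * x u"] eig[of "vs ! i"] bij i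
        by (auto simp: bij_betw_def)
      finally show "(A *\<^sub>v w) $ i = (of_real M \<cdot>\<^sub>v w) $ i" using i by (simp add: w_def)
    qed (use A in \<open>simp add: w_def\<close>)
    moreover have "w \<noteq> 0\<^sub>v n"
    proof
      assume "w = 0\<^sub>v n"
      then have "x (vs ! i) = 0" if "i < n" for i
        using that by (metis index_vec index_zero_vec(1) of_real_eq_0_iff w_def)
      then have "x v = 0" if "v \<in> V" for v
        using that bij by (metis bij_betw_def imageE lessThan_iff)
      then show False using n2 by simp
    qed
    ultimately have "eigenvalue A (of_real M)"
      using w A by (auto simp: eigenvalue_def eigenvector_def)
    then have "norm (of_real M :: complex) \<le> \<rho>"
      unfolding \<rho> by (intro spectral_radius_mem_max(2)[OF A n])
        (auto simp: spectrum_def simp del: norm_of_real intro!: imageI)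
    then show ?thesis by simp
  qed
  moreover have "\<rho> \<le> M"
  proof -
    obtain \<mu> where \<mu>: "eigenvalue A \<mu>" "\<rho> = norm \<mu>"
      using spectral_radius_mem_max(1)[OF A n] by (auto simp: \<rho> spectrum_def)
    then obtain w where w: "w \<in> carrier_vec n" "w \<noteq> 0\<^sub>v n" "A *\<^sub>v w = \<mu> \<cdot>\<^sub>v w"
      using A by (auto simp: eigenvalue_def eigenvector_def)
    define y where "y v = norm (w $ (inv_into {..<n} (\<lambda>i. vs ! i) v))" for v
    have y: "y (vs ! i) = norm (w $ i)" if "i < n" for i
      using that bij by (simp add: y_def bij_betw_def inv_into_f_f)
    have le: "\<rho> * y v \<le> (\<Sum>u\<in>V. a v u * y u)" if "v \<in> V" for v
    proof -
      obtain i where i: "i < n" "v = vs ! i" using \<open>v \<in> V\<close> bij by (auto simp: bij_betw_def)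
      have "\<rho> * y v = norm ((A *\<^sub>v w) $ i)"
        using i w by (simp add: y \<mu>(2) norm_mult)
      also have "\<dots> \<le> (\<Sum>j<n. a v (vs ! j) * y (vs ! j))"
        unfolding mult[OF w(1) i(1)] by (rule order.trans[OF norm_sum])
          (auto intro!: sum_mono simp: norm_mult y i a_def)
      finally show ?thesis using reindex[of "\<lambda>u. a v u * y u"] by simp
    qed
    have "\<rho> * (\<Sum>v\<in>V. (y v)\<^sup>2) = (\<Sum>v\<in>V. y v * (\<rho> * y v))"
      by (simp add: sum_distrib_left power2_eq_square mult_ac)
    also have "\<dots> \<le> (\<Sum>v\<in>V. y v * (\<Sum>u\<in>V. a v u * y u))"
      by (intro sum_mono mult_left_mono le) (auto simp: y_def)
    also have "\<dots> = (\<Sum>v\<in>V. \<Sum>u\<in>V. a v u * y v * y u)"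
      by (simp add: sum_distrib_left mult_ac)
    also have "\<dots> \<le> M * (\<Sum>v\<in>V. (y v)\<^sup>2)" by (rule bd)
    finally have "\<rho> * (\<Sum>v\<in>V. (y v)\<^sup>2) \<le> M * (\<Sum>v\<in>V. (y v)\<^sup>2)" .
    moreover have "(\<Sum>v\<in>V. (y v)\<^sup>2) > 0"
    proof -
      obtain i where i: "i < n" "w $ i \<noteq> 0"
        using w(1,2) by (metis carrier_vecD eq_vecI index_zero_vec)
      then have "vs ! i \<in> V" "y (vs ! i) \<noteq> 0" using bij y by (auto simp: bij_betw_def)
      then show ?thesis using fin by (intro sum_pos2[of V "vs ! i"]) auto
    qed
    ultimately show ?thesis by simp
  qed
  ultimately have M: "M = graph_spectral_radius G" by (simp add: \<rho>_def)
  show ?thesis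
  proof (rule that)
    show "0 \<le> x v" if "v \<in> verts G" for v using x0 that by (simp add: V_def)
    show "\<exists>v\<in>verts G. 0 < x v"
    proof (rule ccontr)
      assume "\<not> ?thesis"
      then have "\<forall>v\<in>V. x v = 0" using x0 by (force simp: V_def)
      then show False using n2 by simp
    qed
    show "graph_spectral_radius G * x v = (\<Sum>u\<in>nbrs G v. x u)" if "v \<in> verts G" for v
    proof -
      have "(\<Sum>u\<in>nbrs G v. x u) = (\<Sum>u\<in>V. a v u * x u)"
        using fin nbrs_subset[OF G, of v]
        by (intro sum.mono_neutral_cong_left) (auto simp: V_def nbrs_def a_def)
      then show ?thesis using eig[of v] that by (simp add: M V_def)
    qed
  qed
qed

section \<open>Components without a path on five vertices\<close>

text \<open>Longer cycles contain a path on five vertices, so only 4-cycles and triangles need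
  attention. Without either, a component with edges is a star or double star, recorded as a tree by
  its degree sum.\<close>

lemma closed_component_without_P5:
  fixes A :: "'a \<Rightarrow> 'a set"
  assumes fin: "finite C" and ne: "C \<noteq> {}" and closed: "\<And>v. v \<in> C \<Longrightarrow> A v \<subseteq> C"
    and sym: "\<And>u v. u \<in> A v \<Longrightarrow> v \<in> A u" and irr: "\<And>v. v \<notin> A v"
    and P5: "\<And>a b c d e. \<lbrakk>distinct [a, b, c, d, e]; set [a, b, c, d, e] \<subseteq> C;
               b \<in> A a; c \<in> A b; d \<in> A c; e \<in> A d\<rbrakk> \<Longrightarrow> False"
  obtains
      (isolated) v where "v \<in> C" "A v = {}"
    | (tree) H where "H \<subseteq> C" "H \<noteq> {}" "\<And>v. v \<in> H \<Longrightarrow> A v \<subseteq> H" "\<And>v. v \<in> H \<Longrightarrow> A v \<noteq> {}"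
        "(\<Sum>v\<in>H. card (A v)) + 2 = 2 * card H"
    | (square) a b c d where "distinct [a, b, c, d]" "{a, b, c, d} \<subseteq> C"
        "b \<in> A a" "c \<in> A b" "d \<in> A c" "a \<in> A d" "\<And>v. v \<in> {a, b, c, d} \<Longrightarrow> A v \<subseteq> {a, b, c, d}"
    | (triangle) v a b L where "distinct [v, a, b]" "{v, a, b} \<subseteq> C" "L \<subseteq> C" "a \<notin> L" "b \<notin> L" "v \<notin> L"
        "A v = insert a (insert b L)" "A a = {v, b}" "A b = {v, a}" "\<And>l. l \<in> L \<Longrightarrow> A l = {v}"
proof -
  have symm: "u \<in> A v \<longleftrightarrow> v \<in> A u" for u v using sym by blast
  have P5': False if "distinct [a, b, c, d, e]" "b \<in> A a" "c \<in> A b" "d \<in> A c" "e \<in> A d" "a \<in> C" for a b c d e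
    using P5[of a b c d e] that closed by auto
  have finA: "finite (A v)" if "v \<in> C" for v using closed[OF that] fin finite_subset by blast
  consider (sq) a b c d where "distinct [a, b, c, d]" "a \<in> C" "b \<in> A a" "c \<in> A b" "d \<in> A c" "a \<in> A d"
    | (tri) v a b where "distinct [v, a, b]" "v \<in> C" "a \<in> A v" "b \<in> A v" "b \<in> A a"
      "\<And>a b c d. \<lbrakk>distinct [a, b, c, d]; a \<in> C; b \<in> A a; c \<in> A b; d \<in> A c; a \<in> A d\<rbrakk> \<Longrightarrow> False"
    | (acyc) "\<And>v a b. \<lbrakk>v \<in> C; a \<in> A v; b \<in> A v; b \<in> A a\<rbrakk> \<Longrightarrow> False"
      "\<And>a b c d. \<lbrakk>distinct [a, b, c, d]; a \<in> C; b \<in> A a; c \<in> A b; d \<in> A c; a \<in> A d\<rbrakk> \<Longrightarrow> False"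
    using irr symm by (metis distinct_length_2_or_more distinct_singleton)
  then show thesis
  proof cases
    case (sq a b c d)
    have H: "{a, b, c, d} \<subseteq> C" using sq closed by blast
    \<comment> \<open>A neighbour z outside the 4-cycle, followed by a walk round the cycle, is a
      path on five vertices.\<close>
    have sub: "A a \<subseteq> {a, b, c, d}" if "distinct [a, b, c, d]" "a \<in> C" "b \<in> A a" "c \<in> A b" "d \<in> A c" "a \<in> A d" for a b c d
    proof
      fix z assume z: "z \<in> A a"
      show "z \<in> {a, b, c, d}"
        using P5'[of z a b c d] z that symm closed by auto
    qed
    have "A v \<subseteq> {a, b, c, d}" if "v \<in> {a, b, c, d}" for v
      using sub[of a b c d] sub[of b c d a] sub[of c d a b] sub[of d a b c] sq H that by auto
    then show thesis using square[of a b c d] sq H by auto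
  next
    case (tri v a b)
    note no4 = tri(6)
    have in_C: "v \<in> C" "a \<in> C" "b \<in> C" using tri closed by blast+
    \<comment> \<open>Two triangle vertices u and p cannot both have outside neighbours: x = y gives
      the 4-cycle x u q p, otherwise x u q p y is a path on five vertices.\<close>
    have one: False if "x \<in> A u" "x \<notin> {u, p, q}" "y \<in> A p" "y \<notin> {u, p, q}" "distinct [u, p, q]"
      "p \<in> A u" "q \<in> A u" "q \<in> A p" "u \<in> C" for u p q x y
    proof (cases "x = y")
      case True
      then show False using no4[of x u q p] that symm closed by (metis distinct_length_2_or_more distinct_singleton insert_iff subsetD)
    next
      case False
      then show False using P5'[of x u q p y] that symm closed by auto
    qed
    \<comment> \<open>Rename the triangle so that v is the only vertex that may have further
      neighbours.\<close>
    have "\<exists>v a b. distinct [v, a, b] \<and> v \<in> C \<and> a \<in> A v \<and> b \<in> A v \<and> b \<in> A a \<and> A a = {v, b} \<and> A b = {v, a}"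
    proof (cases "A a = {v, b} \<and> A b = {v, a}")
      case True
      then show ?thesis using tri by blast
    next
      case False
      have sub: "{v, b} \<subseteq> A a" "{v, a} \<subseteq> A b" "{a, b} \<subseteq> A v" using tri(3-5) sym[OF tri(3)] sym[OF tri(4)] sym[OF tri(5)] by auto
      show ?thesis
      proof (cases "A a = {v, b}")
        case True
        then have "A b \<noteq> {v, a}" using False by simp
        then obtain y where "y \<in> A b" "y \<notin> {v, a}" using sub(2) by auto
        then have y: "y \<in> A b" "y \<notin> {v, a, b}" using irr[of b] by auto
        have "A v = {a, b}"
        proof -
          have "x \<in> {a, b}" if "x \<in> A v" for x
            using one[of x v b a y] that y sub irr[of v] in_C tri(1) by auto
          then show ?thesis using sub by auto
        qed
        then have "distinct [b, v, a] \<and> b \<in> C \<and> v \<in> A b \<and> a \<in> A b \<and> a \<in> A v \<and> A v = {b, a} \<and> A a = {b, v}"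
          using tri(1) True sub in_C by auto
        then show ?thesis by blast
      next
        case False
        then obtain y where "y \<in> A a" "y \<notin> {v, b}" using sub(1) by auto
        then have y: "y \<in> A a" "y \<notin> {v, a, b}" using irr[of a] by auto
        have "x \<in> {a, b}" if "x \<in> A v" for x
          using one[of x v a b y] that y sub irr[of v] in_C tri(1) by auto
        moreover have "x \<in> {v, a}" if "x \<in> A b" for x
          using one[of x b a v y] that y sub irr[of b] in_C tri(1) by auto
        ultimately have "A v = {a, b}" "A b = {v, a}" using sub by blast+
        then have "distinct [a, v, b] \<and> a \<in> C \<and> v \<in> A a \<and> b \<in> A a \<and> b \<in> A v \<and> A v = {a, b} \<and> A b = {a, v}"
          using tri(1) sub in_C by auto
        then show ?thesis by blast
      qed
    qed
    then obtain v a b where vab: "distinct [v, a, b]" "v \<in> C" "a \<in> A v" "b \<in> A v" "b \<in> A a" "A a = {v, b}" "A b = {v, a}"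
      by blast
    define L where "L = A v - {a, b}"
    have "A l = {v}" if l: "l \<in> L" for l
    proof -
      have "v \<in> A l" using l symm by (auto simp: L_def)
      moreover have "z = v" if z: "z \<in> A l" for z
      proof (rule ccontr)
        assume "z \<noteq> v"
        moreover have "l \<notin> {v, a, b}" using l irr by (auto simp: L_def)
        moreover have "z \<noteq> a" "z \<noteq> b" using vab sym[OF z] calculation by auto
        moreover have "z \<noteq> l" using irr z by auto
        moreover have "z \<in> C" using z l closed vab(2) by (auto simp: L_def)
        ultimately show False
          using P5'[of z l v a b] vab l sym[OF z] symm by (auto simp: L_def)
      qed
      ultimately show ?thesis by blast
    qed
    note L = this
    show thesis
    proof (rule triangle[of v a b L])
      show "A v = insert a (insert b L)" using vab(3,4) by (auto simp: L_def)
      show "L \<subseteq> C" using closed[OF vab(2)] by (auto simp: L_def)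
      show "{v, a, b} \<subseteq> C" using closed[OF vab(2)] vab(2-4) by auto
      show "v \<notin> L" using irr[of v] by (auto simp: L_def)
      show "a \<notin> L" "b \<notin> L" by (simp_all add: L_def)
    qed (use vab(1,6,7) L in \<open>simp_all\<close>)
  next
    case acyc
    show thesis
    proof (cases "\<exists>v\<in>C. A v = {}")
      case True
      then show thesis using isolated by blast
    next
      case False
      then have nonempty: "\<And>v. v \<in> C \<Longrightarrow> A v \<noteq> {}" by blast
      have "\<exists>p q Lp Lq. p \<in> C \<and> q \<in> C \<and> p \<noteq> q \<and> A p = insert q Lp \<and> A q = insert p Lq \<and>
        q \<notin> Lp \<and> p \<notin> Lq \<and> Lp \<inter> Lq = {} \<and> p \<notin> Lp \<and> q \<notin> Lq \<and> (\<forall>l\<in>Lp. A l = {p}) \<and> (\<forall>l\<in>Lq. A l = {q})"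
      proof -
        \<comment> \<open>pq is the central edge of a star or double star: the middle of a path a p
          q b if there is one, otherwise any edge at a vertex of degree at least two, or a lone
          edge.\<close>
        obtain p q where pq: "p \<in> C" "q \<in> A p"
          and leaf: "\<And>l. l \<in> A p - {q} \<Longrightarrow> A l = {p}" "\<And>l. l \<in> A q - {p} \<Longrightarrow> A l = {q}"
        proof (cases "\<exists>a p q b. p \<in> C \<and> distinct [a, p, q, b] \<and> a \<in> A p \<and> q \<in> A p \<and> b \<in> A q")
          case True
          then obtain a p q b where h: "p \<in> C" "distinct [a, p, q, b]" "a \<in> A p" "q \<in> A p" "b \<in> A q" by blast
          \<comment> \<open>A further neighbour z of l would start the path z l p q b; each possible
            coincidence of its vertices gives a triangle or a 4-cycle.\<close>
          have leaf: "A l = {p}" if "l \<in> A p - {q}" "p \<in> C" "q \<in> A p" "b \<in> A q" "b \<noteq> p" for l p q b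
          proof -
            have lC: "l \<in> C" "q \<in> C" "b \<in> C" using that closed by blast+
            have "z = p" if z: "z \<in> A l" for z
            proof (rule ccontr)
              assume zp: "z \<noteq> p"
              have 1: "z \<noteq> l" "q \<noteq> p" "b \<noteq> q" "l \<noteq> p" "l \<noteq> q"
                using z irr \<open>q \<in> A p\<close> \<open>b \<in> A q\<close> \<open>l \<in> A p - {q}\<close> by auto
              have 2: "z \<noteq> q" using acyc(1)[of p l q] z \<open>l \<in> A p - {q}\<close> \<open>q \<in> A p\<close> \<open>p \<in> C\<close> by auto
              have 3: "l \<noteq> b" using acyc(1)[of p q b] \<open>l \<in> A p - {q}\<close> \<open>q \<in> A p\<close> \<open>p \<in> C\<close> \<open>b \<in> A q\<close> by auto
              have 4: "z \<noteq> b"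
                using acyc(2)[of l p q b] 1 2 3 z zp lC \<open>l \<in> A p - {q}\<close> \<open>q \<in> A p\<close> \<open>b \<in> A q\<close> symm \<open>b \<noteq> p\<close> by auto
              have "z \<in> C" using z lC closed by blast
              then show False
                using P5'[of z l p q b] 1 2 3 4 zp z \<open>l \<in> A p - {q}\<close> \<open>q \<in> A p\<close> \<open>b \<in> A q\<close> symm \<open>b \<noteq> p\<close> by auto
            qed
            moreover have "p \<in> A l" using that symm by auto
            ultimately show ?thesis by blast
          qed
          show thesis
          proof (rule that[of p q])
            show "A l = {p}" if "l \<in> A p - {q}" for l using leaf[of l p q b] that h by auto
            show "A l = {q}" if "l \<in> A q - {p}" for l using leaf[of l q p a] that h closed symm by auto
          qed (use h in auto)
        next
          case False
          note noP4 = this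
          have noP4: False if "p \<in> C" "a \<in> A p" "q \<in> A p" "b \<in> A q" "a \<noteq> q" "b \<noteq> p" for a p q b
          proof -
            have "a \<noteq> p" "q \<noteq> p" "b \<noteq> q" using that irr by auto
            moreover have "a \<noteq> b" using acyc(1)[of p q a] that by auto
            ultimately show False using False that by auto
          qed
          show thesis
          proof (cases "\<exists>p\<in>C. \<exists>a\<in>A p. \<exists>b\<in>A p. a \<noteq> b")
            case True
            then obtain p a b where h: "p \<in> C" "a \<in> A p" "b \<in> A p" "a \<noteq> b" by blast
            have l: "A l = {p}" if "l \<in> A p" for l
            proof -
              obtain a' where "a' \<in> A p" "a' \<noteq> l" using h by blast
              then have "z = p" if "z \<in> A l" for z
                using noP4[of p a' l z] \<open>l \<in> A p\<close> h(1) that by auto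
              moreover have "p \<in> A l" using that symm by auto
              ultimately show ?thesis by blast
            qed
            show thesis by (rule that[of p a]) (use l h in auto)
          next
            case False
            obtain p where p: "p \<in> C" using ne by blast
            then obtain q where q: "q \<in> A p" using nonempty by blast
            have "A p = {q}" using False p q by blast
            moreover have "A q = {p}" using False p q symm closed by blast
            ultimately show thesis using that[of p q] p by auto
          qed
        qed
        show ?thesis
        proof (intro exI conjI ballI)
          show "p \<in> C" "q \<in> C" using pq closed by blast+
          show "p \<noteq> q" using pq irr by auto
          show "A p = insert q (A p - {q})" "A q = insert p (A q - {p})" using pq symm by auto
          show "(A p - {q}) \<inter> (A q - {p}) = {}" using acyc(1)[of p q] pq by auto
          show "q \<notin> A p - {q}" "p \<notin> A q - {p}" "p \<notin> A p - {q}" "q \<notin> A q - {p}"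
            by (simp_all add: irr)
          show "A l = {p}" if "l \<in> A p - {q}" for l using leaf(1) that by blast
          show "A l = {q}" if "l \<in> A q - {p}" for l using leaf(2) that by blast
        qed
      qed
      then obtain p q Lp Lq where h: "p \<in> C" "q \<in> C" "p \<noteq> q" "A p = insert q Lp" "A q = insert p Lq"
        "q \<notin> Lp" "p \<notin> Lq" "Lp \<inter> Lq = {}" "p \<notin> Lp" "q \<notin> Lq" "\<And>l. l \<in> Lp \<Longrightarrow> A l = {p}" "\<And>l. l \<in> Lq \<Longrightarrow> A l = {q}"
        by metis
      have f: "finite Lp" "finite Lq" using finA[of p] finA[of q] h by auto
      have LC: "Lp \<subseteq> C" "Lq \<subseteq> C" using closed[of p] closed[of q] h by auto
      define H where "H = insert p (insert q (Lp \<union> Lq))"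
      have "card H = 2 + card Lp + card Lq" using h f by (simp add: H_def card_Un_disjoint)
      moreover have "(\<Sum>v\<in>H. card (A v)) = (1 + card Lp) + (1 + card Lq) + (card Lp + card Lq)"
        using h f by (simp add: H_def sum.union_disjoint)
      ultimately have "(\<Sum>v\<in>H. card (A v)) + 2 = 2 * card H" by simp
      moreover have "A v \<subseteq> H" "A v \<noteq> {}" if "v \<in> H" for v
        using that h by (auto simp: H_def)
      moreover have "H \<subseteq> C" "H \<noteq> {}" using h LC by (auto simp: H_def)
      ultimately show thesis using tree[of H] by blast
    qed
  qed
qed

section \<open>Charges\<close>

text \<open>\<open>x\<close> is the Perron vector scaled to maximum 1 at \<open>u0\<close>. The
  assumption \<open>l_m\<close> says that \<open>l\<close> is at least the bound of the
  theorem.\<close>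

locale perron_graph =
  fixes V :: "'a set" and A :: "'a \<Rightarrow> 'a set" and x :: "'a \<Rightarrow> real" and l :: real and m :: nat and u0 :: 'a
  assumes fin: "finite V" and A_sub: "A v \<subseteq> V" and A_sym: "u \<in> A v \<longleftrightarrow> v \<in> A u" and A_irr: "v \<notin> A v"
    and A_ne: "v \<in> V \<Longrightarrow> A v \<noteq> {}"
    and x_nonneg: "v \<in> V \<Longrightarrow> 0 \<le> x v" and x_le1: "v \<in> V \<Longrightarrow> x v \<le> 1"
    and u0: "u0 \<in> V" and x_u0: "x u0 = 1"
    and eigen: "v \<in> V \<Longrightarrow> l * x v = (\<Sum>u\<in>A v. x u)"
    and handshake: "(\<Sum>v\<in>V. card (A v)) = 2 * m"
    and l_gt3: "3 < l" and l_m: "real m - 1 \<le> l\<^sup>2 - l"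
begin

section \<open>The vertex u0, its neighbours and the outer vertices\<close>

definition N where "N = A u0"
definition W where "W = V - insert u0 N"
abbreviation "nN v \<equiv> A v \<inter> N"
abbreviation "nW v \<equiv> A v \<inter> W"
abbreviation "dN v \<equiv> real (card (nN v))"
abbreviation "dW v \<equiv> real (card (nW v))"

lemma N_sub: "N \<subseteq> V" and W_sub: "W \<subseteq> V" and u0_N: "u0 \<notin> N" and u0_W: "u0 \<notin> W"
  and N_W: "N \<inter> W = {}" and V_eq: "insert u0 (N \<union> W) = V"
  using A_sub A_irr u0 by (auto simp: N_def W_def)

lemma finN: "finite N" and finW: "finite W" and finA: "finite (A v)"
  by (rule finite_subset[OF N_sub fin] finite_subset[OF W_sub fin] finite_subset[OF A_sub fin])+

lemma u0_adj: "u \<in> N \<Longrightarrow> u0 \<in> A u" "u \<in> N \<Longrightarrow> u \<in> A u0"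
  using A_sym by (auto simp: N_def)

lemma xN: "u \<in> N \<Longrightarrow> 0 \<le> x u" "u \<in> N \<Longrightarrow> x u \<le> 1" and xW: "w \<in> W \<Longrightarrow> 0 \<le> x w" "w \<in> W \<Longrightarrow> x w \<le> 1"
  using N_sub W_sub x_nonneg x_le1 by auto

lemma A_N: "u \<in> N \<Longrightarrow> A u = insert u0 (nN u \<union> nW u)"
  using u0_adj(1)[of u] A_sub[of u] V_eq by blast

lemma A_W: "w \<in> W \<Longrightarrow> A w = nN w \<union> nW w"
  using A_sub[of w] V_eq A_sym[of u0 w] unfolding N_def W_def by blast

lemma disj: "nN u \<inter> nW u = {}" "u0 \<notin> nN u \<union> nW u"
  using N_W u0_N u0_W by auto

lemma sum_A_N: "u \<in> N \<Longrightarrow> sum f (A u) = f u0 + sum f (nN u) + sum f (nW u)" for f :: "'a \<Rightarrow> 'b::comm_monoid_add"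
  using disj[of u] by (subst A_N) (simp_all add: finA sum.union_disjoint add.assoc)

lemma sum_A_W: "w \<in> W \<Longrightarrow> sum f (A w) = sum f (nN w) + sum f (nW w)" for f :: "'a \<Rightarrow> 'b::comm_monoid_add"
  using disj[of w] by (subst A_W) (simp_all add: finA sum.union_disjoint)

lemma eigen_u0: "l = sum x N"
  using eigen[OF u0] x_u0 by (simp add: N_def)

lemma eigen_N: "u \<in> N \<Longrightarrow> l * x u = 1 + sum x (nN u) + sum x (nW u)"
  using eigen[of u] sum_A_N[of u x] x_u0 N_sub by auto

lemma eigen_W: "w \<in> W \<Longrightarrow> l * x w = sum x (nN w) + sum x (nW w)"
  using eigen[of w] sum_A_W[of w x] W_sub by auto

text \<open>\<open>u0\<close> alone contributes 1 to the eigenvalue equation of u. Elsewhere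
  \<open>x\<close> may vanish, since the graph need not be connected.\<close>

lemma x_pos_N: "u \<in> N \<Longrightarrow> 0 < x u"
proof -
  assume u: "u \<in> N"
  have "0 \<le> sum x (nN u)" "0 \<le> sum x (nW u)" using xN xW by (auto intro!: sum_nonneg)
  then have "0 < l * x u" using eigen_N[OF u] by linarith
  then show ?thesis using l_gt3 by (simp add: zero_less_mult_iff)
qed

lemma sum_nbr_swap:
  fixes f :: "'a \<Rightarrow> real"
  assumes "finite P" "finite Q"
  shows "(\<Sum>u\<in>P. \<Sum>w\<in>A u \<inter> Q. f w) = (\<Sum>w\<in>Q. real (card (A w \<inter> P)) * f w)"
proof -
  have "(\<Sum>u\<in>P. \<Sum>w\<in>A u \<inter> Q. f w) = (\<Sum>u\<in>P. \<Sum>w\<in>{w\<in>Q. w \<in> A u}. f w)"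
    by (intro sum.cong) auto
  also have "\<dots> = (\<Sum>w\<in>Q. \<Sum>u\<in>{u\<in>P. w \<in> A u}. f w)"
    by (rule sum.swap_restrict[OF assms])
  also have "\<dots> = (\<Sum>w\<in>Q. real (card (A w \<inter> P)) * f w)"
  proof (intro sum.cong refl)
    fix w
    have "{u\<in>P. w \<in> A u} = A w \<inter> P" using A_sym by auto
    then show "(\<Sum>u\<in>{u\<in>P. w \<in> A u}. f w) = real (card (A w \<inter> P)) * f w" by simp
  qed
  finally show ?thesis .
qed

lemma sum_V: "sum f V = f u0 + sum f N + sum f W" for f :: "'a \<Rightarrow> 'b::comm_monoid_add"
proof -
  have "sum f (insert u0 (N \<union> W)) = f u0 + sum f N + sum f W"
    using u0_N u0_W N_W by (simp add: finN finW sum.union_disjoint add.assoc)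
  then show ?thesis by (simp only: V_eq)
qed

text \<open>The edges at \<open>u0\<close> account for \<open>2 * card N\<close>, and edges between
  N and W are met from both ends.\<close>

lemma edge_count: "2 * real m = 2 * real (card N) + (\<Sum>u\<in>N. dN u) + 2 * (\<Sum>w\<in>W. dN w) + (\<Sum>w\<in>W. dW w)"
proof -
  have N: "real (card (A u)) = 1 + dN u + dW u" if "u \<in> N" for u
    using sum_A_N[OF that, of "\<lambda>_. 1::real"] by simp
  have W: "real (card (A w)) = dN w + dW w" if "w \<in> W" for w
    using sum_A_W[OF that, of "\<lambda>_. 1::real"] by simp
  have "2 * real m = (\<Sum>v\<in>V. real (card (A v)))"
    using handshake by (metis of_nat_sum of_nat_mult of_nat_numeral)
  also have "\<dots> = real (card N) + (\<Sum>u\<in>N. 1 + dN u + dW u) + (\<Sum>w\<in>W. dN w + dW w)"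
    unfolding sum_V using N W by (simp add: N_def[symmetric])
  finally have "2 * real m = 2 * real (card N) + (\<Sum>u\<in>N. dN u) + (\<Sum>u\<in>N. dW u) + (\<Sum>w\<in>W. dN w) + (\<Sum>w\<in>W. dW w)"
    by (simp add: sum.distrib)
  moreover have "(\<Sum>u\<in>N. dW u) = (\<Sum>w\<in>W. dN w)"
    using sum_nbr_swap[OF finN finW, of "\<lambda>_. 1"] by simp
  ultimately show ?thesis by linarith
qed

text \<open>Halving the degree splits each edge between its ends, so that the sum over a component H
  of G[N] is e(H) minus the sum of (d(u) - 1) x(u).\<close>

definition \<phi>0 where "\<phi>0 u = dN u / 2 - (dN u - 1) * x u"

text \<open>Expand \<open>(\<lambda>\<^sup>2 - \<lambda>) x(u0)\<close> through walks of length two and compare with \<open>m - 1\<close>.\<close>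

lemma charge_bound: "(\<Sum>u\<in>N. \<phi>0 u) + (\<Sum>w\<in>W. dN w * (1 - x w) + dW w / 2) \<le> 1"
proof -
  have "l\<^sup>2 = (\<Sum>u\<in>N. l * x u)"
    using eigen_u0 by (metis power2_eq_square sum_distrib_left)
  also have "\<dots> = real (card N) + (\<Sum>u\<in>N. sum x (nN u)) + (\<Sum>u\<in>N. sum x (nW u))"
    using eigen_N by (simp add: sum.distrib)
  also have "\<dots> = real (card N) + (\<Sum>u\<in>N. dN u * x u) + (\<Sum>w\<in>W. dN w * x w)"
    using sum_nbr_swap[OF finN finN] sum_nbr_swap[OF finN finW] by simp
  finally have "l\<^sup>2 - l = real (card N) + (\<Sum>u\<in>N. (dN u - 1) * x u) + (\<Sum>w\<in>W. dN w * x w)"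
    using eigen_u0 by (simp add: sum_subtractf algebra_simps)
  then show ?thesis
    using l_m edge_count
    by (simp add: \<phi>0_def sum.distrib sum_subtractf right_diff_distrib sum_divide_distrib[symmetric])
qed

text \<open>Closed sets are the unions of components of the graph induced on \<open>N\<close>.\<close>

definition closedN where "closedN C \<longleftrightarrow> C \<subseteq> N \<and> (\<forall>v\<in>C. nN v \<subseteq> C)"

text \<open>The degree condition says \<open>e(H) = |H| - 1\<close>.\<close>

definition treeN where
  "treeN H \<longleftrightarrow> closedN H \<and> H \<noteq> {} \<and> (\<forall>v\<in>H. nN v \<noteq> {}) \<and> (\<Sum>v\<in>H. card (nN v)) + 2 = 2 * card H"

lemma closedN_N: "closedN N" by (auto simp: closedN_def)

lemma closedN_finite: "closedN C \<Longrightarrow> finite C"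
  using finN finite_subset by (auto simp: closedN_def)

lemma closedN_Diff: "closedN C \<Longrightarrow> closedN H \<Longrightarrow> closedN (C - H)"
  using A_sym by (fastforce simp: closedN_def)

text \<open>Peel off closed parts one by one; what remains of a closed set is again closed.\<close>

lemma closedN_sum_nonneg:
  fixes f :: "'a \<Rightarrow> real"
  assumes part: "\<And>C. closedN C \<Longrightarrow> C \<noteq> {} \<Longrightarrow> \<exists>H\<subseteq>C. closedN H \<and> H \<noteq> {} \<and> 0 \<le> sum f H"
    and C: "closedN C"
  shows "0 \<le> sum f C"
  using closedN_finite[OF C] C
proof (induction C rule: finite_psubset_induct)
  case (psubset C)
  show ?case
  proof (cases "C = {}")
    case False
    then obtain H where H: "H \<subseteq> C" "closedN H" "H \<noteq> {}" "0 \<le> sum f H"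
      using part psubset by blast
    then have "0 \<le> sum f (C - H)"
      using psubset closedN_Diff by (intro psubset.IH) auto
    then show ?thesis using sum.subset_diff[OF H(1), of f] psubset H by simp
  qed simp
qed

text \<open>With e(H) = |H| - 1 the charge becomes 1 plus the sum of (d(v) - 1)(1 - x(v)), all terms
  being nonnegative. The second claim is the case of equality at inner vertices.\<close>

lemma tree_charge:
  assumes H: "treeN H"
  shows "1 \<le> sum \<phi>0 H"
    and "sum \<phi>0 H \<le> 1 \<Longrightarrow> v \<in> H \<Longrightarrow> card (nN v) \<ge> 2 \<Longrightarrow> x v = 1"
proof -
  have fH: "finite H" and HN: "H \<subseteq> N" using H closedN_finite by (auto simp: treeN_def closedN_def)
  have d1: "1 \<le> dN v" if "v \<in> H" for v
    using H that finA[of v] by (auto simp: treeN_def Suc_le_eq card_gt_0_iff)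
  have "(\<Sum>v\<in>H. dN v) + 2 = 2 * real (card H)"
  proof -
    have "real ((\<Sum>v\<in>H. card (nN v)) + 2) = real (2 * card H)" using H by (simp add: treeN_def)
    then show ?thesis by simp
  qed
  then have eq: "sum \<phi>0 H = 1 + (\<Sum>v\<in>H. (dN v - 1) * (1 - x v))"
    by (simp add: \<phi>0_def sum_subtractf algebra_simps sum.distrib sum_divide_distrib[symmetric])
  have nn: "0 \<le> (dN v - 1) * (1 - x v)" if "v \<in> H" for v
    using d1[OF that] xN(2)[of v] HN that by auto
  then show "1 \<le> sum \<phi>0 H" unfolding eq by (simp add: sum_nonneg)
  assume "sum \<phi>0 H \<le> 1" and v: "v \<in> H" "card (nN v) \<ge> 2"
  then have "(\<Sum>v\<in>H. (dN v - 1) * (1 - x v)) \<le> 0" unfolding eq by simp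
  then have "(dN v - 1) * (1 - x v) \<le> 0"
    using member_le_sum[of v H "\<lambda>v. (dN v - 1) * (1 - x v)"] nn fH v by force
  moreover have "0 < dN v - 1" using v by simp
  ultimately have "1 - x v \<le> 0" by (metis mult_le_0_iff not_le order.refl)
  then show "x v = 1" using xN(2)[of v] v HN by force
qed

section \<open>Rigidity when no component contains a cycle\<close>

lemma isolated_charge: "nN v = {} \<Longrightarrow> \<phi>0 v = x v" by (simp add: \<phi>0_def)

lemma isolated_closed: "v \<in> N \<Longrightarrow> nN v = {} \<Longrightarrow> closedN {v}" by (auto simp: closedN_def)

text \<open>Nonempty closed sets have positive charge and a tree uses the whole budget 1, so N is
  one tree and every inequality is tight. \<open>hW\<close> excludes an outer vertex joined to all
  of N, which tightness alone would permit.\<close>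

lemma star_if_forest:
  assumes forest: "\<And>C. closedN C \<Longrightarrow> C \<noteq> {} \<Longrightarrow> (\<exists>v\<in>C. nN v = {}) \<or> (\<exists>H\<subseteq>C. treeN H)"
    and hW: "\<And>a p b c w. \<lbrakk>distinct [a, p, b, c]; {a, p, b, c} \<subseteq> N; p \<in> A a; b \<in> A p; w \<in> W; N \<subseteq> A w\<rbrakk> \<Longrightarrow> False"
  shows "\<exists>p\<in>N. V = insert u0 N \<and> nN p = N - {p} \<and> (\<forall>u\<in>N - {p}. nN u = {p})"
proof -
  have nonneg: "0 \<le> sum \<phi>0 C" if "closedN C" for C
  proof (rule closedN_sum_nonneg[OF _ that])
    fix C assume C: "closedN C" "C \<noteq> {}"
    consider v where "v \<in> C" "nN v = {}" | H where "H \<subseteq> C" "treeN H" using forest[OF C] by blast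
    then show "\<exists>H\<subseteq>C. closedN H \<and> H \<noteq> {} \<and> 0 \<le> sum \<phi>0 H"
    proof cases
      case (1 v)
      then have v: "v \<in> N" using C by (auto simp: closedN_def)
      then show ?thesis using 1 isolated_charge isolated_closed xN(1)
        by (intro exI[of _ "{v}"]) auto
    next
      case (2 H)
      then show ?thesis using tree_charge(1)[of H] by (intro exI[of _ H]) (auto simp: treeN_def)
    qed
  qed
  have pos: "0 < sum \<phi>0 C" if C: "closedN C" "C \<noteq> {}" for C
  proof -
    consider v where "v \<in> C" "nN v = {}" | H where "H \<subseteq> C" "treeN H" using forest[OF C] by blast
    then obtain H where H: "H \<subseteq> C" "closedN H" "0 < sum \<phi>0 H"
    proof cases
      case (1 v)
      then have v: "v \<in> N" using C by (auto simp: closedN_def)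
      then show ?thesis using 1 isolated_charge isolated_closed x_pos_N that[of "{v}"] by auto
    next
      case (2 H)
      then show ?thesis using tree_charge(1)[of H] that[of H] by (auto simp: treeN_def)
    qed
    have "0 \<le> sum \<phi>0 (C - H)" using nonneg closedN_Diff C H by auto
    then show ?thesis using sum.subset_diff[OF H(1), of \<phi>0] closedN_finite[OF C(1)] H by simp
  qed
  have termW: "0 \<le> dN w * (1 - x w) + dW w / 2" if "w \<in> W" for w using xW[OF that] by simp
  then have sumW: "0 \<le> (\<Sum>w\<in>W. dN w * (1 - x w) + dW w / 2)" by (rule sum_nonneg)
  have le1: "sum \<phi>0 N \<le> 1" using charge_bound sumW by simp
  \<comment> \<open>Otherwise every vertex of N is isolated in G[N], and the charge of N is the sum
    of x over N, that is \<open>l\<close>.\<close>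
  have "\<exists>H. treeN H"
  proof -
    define C where "C = {v\<in>N. nN v \<noteq> {}}"
    have cC: "closedN C" using A_sym by (fastforce simp: closedN_def C_def)
    have "C \<noteq> {}"
    proof
      assume "C = {}"
      then have "sum \<phi>0 N = sum x N" using isolated_charge by (intro sum.cong) (auto simp: C_def)
      then show False using le1 l_gt3 eigen_u0 by simp
    qed
    from forest[OF cC this] show ?thesis by (auto simp: C_def)
  qed
  then obtain H where H: "treeN H" by blast
  then have HN: "H \<subseteq> N" by (simp add: treeN_def closedN_def)
  have "N - H = {}"
  proof (rule ccontr)
    assume "N - H \<noteq> {}"
    then have "0 < sum \<phi>0 (N - H)" using H closedN_N closedN_Diff by (intro pos) (auto simp: treeN_def)
    then show False using sum.subset_diff[OF HN finN, of \<phi>0] tree_charge(1)[OF H] le1 by simp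
  qed
  then have tN: "treeN N" using H HN by (metis Diff_eq_empty_iff subset_antisym)
  have W0: "dN w * (1 - x w) + dW w / 2 = 0" if "w \<in> W" for w
  proof -
    have "(\<Sum>w\<in>W. dN w * (1 - x w) + dW w / 2) \<le> 0" using charge_bound tree_charge(1)[OF tN] by simp
    with sumW have "(\<Sum>w\<in>W. dN w * (1 - x w) + dW w / 2) = 0" by simp
    from sum_nonneg_0[OF finW _ this that] show ?thesis using termW by blast
  qed
  have d1: "1 \<le> card (nN v)" if "v \<in> N" for v
    using tN that finA[of v] by (auto simp: treeN_def Suc_le_eq card_gt_0_iff)
  have dsum: "(\<Sum>v\<in>N. card (nN v)) + 2 = 2 * card N" using tN by (simp add: treeN_def)
  have cN: "3 < card N"
  proof -
    have "l \<le> (\<Sum>v\<in>N. 1)" unfolding eigen_u0 using xN(2) by (intro sum_mono) auto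
    then show ?thesis using l_gt3 by simp
  qed
  \<comment> \<open>If all degrees were 1, the tree equation would give
    \<open>card N = 2\<close>.\<close>
  have "\<exists>p\<in>N. 2 \<le> card (nN p)"
  proof (rule ccontr)
    assume "\<not> ?thesis"
    then have "card (nN v) = 1" if "v \<in> N" for v using d1[OF that] that by force
    then have "(\<Sum>v\<in>N. card (nN v)) = card N" by simp
    then show False using dsum cN by simp
  qed
  then obtain p where p: "p \<in> N" "2 \<le> card (nN p)" by blast
  have xp: "x p = 1" using tree_charge(2)[OF tN le1 p] .
  \<comment> \<open>Tightness leaves an outer w with x w = 1 and all its neighbours in N. Its
    eigenvalue equation then has the same total as that of u0, so w is joined to all of N.\<close>
  have Wempty: "W = {}"
  proof (rule ccontr)
    assume "W \<noteq> {}"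
    then obtain w where w: "w \<in> W" by blast
    have 0: "dN w * (1 - x w) = 0" "dW w = 0" using W0[OF w] xW[OF w]
      by (smt (verit) divide_nonneg_nonneg mult_nonneg_nonneg of_nat_0_le_iff field_sum_of_halves)+
    then have nWw: "nW w = {}" using finA by simp
    then have "nN w \<noteq> {}" using A_W[OF w] A_ne[of w] w W_sub by auto
    then have "x w = 1" using 0 finA[of w] by simp
    then have "sum x N = sum x (nN w)" using eigen_W[OF w] eigen_u0 nWw by simp
    moreover have "sum x N = sum x (nN w) + sum x (N - nN w)"
      using sum.subset_diff[OF _ finN, of "nN w" x] by simp
    ultimately have "sum x (N - nN w) = 0" by simp
    then have "N - nN w = {}"
      using finN x_pos_N by (metis DiffD1 finite_Diff less_irrefl sum_pos)
    then have Nw: "N \<subseteq> A w" by auto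
    obtain a b where ab: "a \<in> nN p" "b \<in> nN p" "a \<noteq> b"
      using p(2) by (metis card_le_Suc0_iff_eq finA finite_Int not_less_eq_eq numeral_2_eq_2)
    have "card {a, p, b} \<le> 3" by (simp add: card_insert_if)
    then have "\<not> N \<subseteq> {a, p, b}" using cN card_mono[of "{a,p,b}" N] by auto
    then obtain c where c: "c \<in> N" "c \<notin> {a, p, b}" by blast
    show False
      by (rule hW[of a p b c w]) (use ab c p w Nw A_sym[of a p] A_irr[of p] in auto)
  qed
  have split: "sum x N = sum x (nN p) + sum x (N - nN p)"
    using sum.subset_diff[OF _ finN, of "nN p" x] by simp
  have "l * 1 = 1 + sum x (nN p)" using eigen_N[OF p(1)] xp Wempty by simp
  \<comment> \<open>Outside the neighbourhood of p, N has weight 1 = x p, and positivity leaves only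
    p there.\<close>
  then have one: "sum x (N - nN p) = 1" using split eigen_u0 by simp
  have "p \<in> N - nN p" using p A_irr by auto
  then have "sum x (N - nN p) = x p + sum x (N - nN p - {p})" using finN by (intro sum.remove) auto
  then have "sum x (N - nN p - {p}) = 0" using one xp by simp
  then have "N - nN p - {p} = {}"
    using finN x_pos_N by (metis DiffD1 finite_Diff less_irrefl sum_pos)
  then have nNp: "nN p = N - {p}" using A_irr by auto
  have "(\<Sum>v\<in>N. card (nN v)) = card (nN p) + (\<Sum>v\<in>N - {p}. card (nN v))"
    using finN p by (intro sum.remove) auto
  \<comment> \<open>The other vertices have average degree 1 in G[N] and each has degree at least 1,
    so all are leaves.\<close>
  then have "(\<Sum>v\<in>N - {p}. card (nN v)) = (\<Sum>v\<in>N - {p}. 1)"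
    using dsum p(1) finN cN by (simp add: nNp)
  note eq = this
  have "nN v = {p}" if v: "v \<in> N - {p}" for v
  proof -
    have "1 = card (nN v)"
    proof (rule sum_mono_inv[OF eq[symmetric] _ v])
      show "1 \<le> card (nN u)" if "u \<in> N - {p}" for u using d1[of u] that by blast
      show "finite (N - {p})" using finN by (rule finite_Diff)
    qed
    then obtain q where "nN v = {q}" by (metis card_1_singletonE)
    moreover have "v \<in> nN p" using v nNp by simp
    then have "p \<in> nN v" using p(1) A_sym by blast
    ultimately show ?thesis by simp
  qed
  moreover have "V = insert u0 N" using V_eq Wempty by simp
  ultimately show ?thesis using p(1) nNp by blast
qed

lemma component_cases:
  assumes C: "closedN C" "C \<noteq> {}"
    and P5: "\<And>a b c d e. \<lbrakk>distinct [a, b, c, d, e]; {a, b, c, d, e} \<subseteq> N;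
               b \<in> A a; c \<in> A b; d \<in> A c; e \<in> A d\<rbrakk> \<Longrightarrow> False"
  obtains
      (isolated) v where "v \<in> C" "nN v = {}"
    | (tree) H where "H \<subseteq> C" "treeN H"
    | (square) a b c d where "distinct [a, b, c, d]" "{a, b, c, d} \<subseteq> C"
        "b \<in> A a" "c \<in> A b" "d \<in> A c" "a \<in> A d" "closedN {a, b, c, d}"
    | (triangle) v a b L where "distinct [v, a, b]" "insert v (insert a (insert b L)) \<subseteq> C" "a \<notin> L" "b \<notin> L" "v \<notin> L"
        "nN v = insert a (insert b L)" "nN a = {v, b}" "nN b = {v, a}" "\<And>l. l \<in> L \<Longrightarrow> nN l = {v}"
proof -
  \<comment> \<open>Without the cut-off the relation is not symmetric: \<open>nN v\<close> may be
    nonempty for v outside N.\<close>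
  define B where "B v = (if v \<in> N then nN v else {})" for v
  have CN: "C \<subseteq> N" using C by (simp add: closedN_def)
  have B: "v \<in> C \<Longrightarrow> B v = nN v" for v using CN by (auto simp: B_def)
  show thesis
  proof (rule closed_component_without_P5[of C B])
    show "finite C" using C closedN_finite by blast
    show "C \<noteq> {}" by fact
    show "B v \<subseteq> C" if "v \<in> C" for v using C that by (auto simp: B_def closedN_def)
    show "v \<in> B u" if "u \<in> B v" for u v
      using that A_sym[of u v] by (auto simp: B_def split: if_splits)
    show "v \<notin> B v" for v using A_irr by (auto simp: B_def)
    show False if "distinct [a, b, c, d, e]" "set [a, b, c, d, e] \<subseteq> C" "b \<in> B a" "c \<in> B b" "d \<in> B c" "e \<in> B d"
      for a b c d e
      by (rule P5[of a b c d e]) (use that CN in \<open>auto simp: B_def split: if_splits\<close>)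
  next
    fix v assume "v \<in> C" "B v = {}"
    then show thesis using isolated B by auto
  next
    fix H assume H: "H \<subseteq> C" "H \<noteq> {}" "\<And>v. v \<in> H \<Longrightarrow> B v \<subseteq> H" "\<And>v. v \<in> H \<Longrightarrow> B v \<noteq> {}"
        "(\<Sum>v\<in>H. card (B v)) + 2 = 2 * card H"
    have BH: "B v = nN v" if "v \<in> H" for v using that H(1) B by blast
    have "(\<Sum>v\<in>H. card (nN v)) = (\<Sum>v\<in>H. card (B v))" using BH by (intro sum.cong) auto
    then have "treeN H" using H BH CN by (auto simp: treeN_def closedN_def)
    then show thesis using tree H by blast
  next
    fix a b c d assume h: "distinct [a, b, c, d]" "{a, b, c, d} \<subseteq> C"
        "b \<in> B a" "c \<in> B b" "d \<in> B c" "a \<in> B d" "\<And>v. v \<in> {a, b, c, d} \<Longrightarrow> B v \<subseteq> {a, b, c, d}"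
    have e: "B a = nN a" "B b = nN b" "B c = nN c" "B d = nN d" using h(2) B by auto
    show thesis
    proof (rule square[of a b c d])
      show "closedN {a, b, c, d}" unfolding closedN_def
        using h(2,7) B CN by (metis subset_iff)
    qed (use h(1-6) e in auto)
  next
    fix v a b L assume h: "distinct [v, a, b]" "{v, a, b} \<subseteq> C" "L \<subseteq> C" "a \<notin> L" "b \<notin> L" "v \<notin> L"
        "B v = insert a (insert b L)" "B a = {v, b}" "B b = {v, a}" "\<And>l. l \<in> L \<Longrightarrow> B l = {v}"
    have e: "B a = nN a" "B b = nN b" "B v = nN v" using h(2) B by auto
    show thesis
    proof (rule triangle[of v a b L])
      show "nN l = {v}" if "l \<in> L" for l using h(3,10) B that by blast
    qed (use h(1-9) e in auto)
  qed
qed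

end

section \<open>The case r = 4\<close>

context perron_graph
begin

text \<open>The weight \<open>dN w * (1 - x w) + dW w / 2\<close> of an outer vertex \<open>w\<close> in \<open>charge_bound\<close> is shared equally
  among its neighbours in \<open>N\<close>, so that \<open>\<phi>\<close> is additive over closed sets.  Only \<open>w\<close> with
  \<open>dN w > 0\<close> contribute.\<close>

definition share where "share w = (1 - x w) + dW w / (2 * dN w)"

definition \<phi> where "\<phi> u = \<phi>0 u + (\<Sum>w\<in>nW u. share w)"

lemma share_nonneg: "w \<in> W \<Longrightarrow> 0 \<le> share w"
  using xW(2)[of w] by (simp add: share_def)

lemma \<phi>0_le: "\<phi>0 u \<le> \<phi> u"
  by (auto simp: \<phi>_def intro!: sum_nonneg share_nonneg)

lemma sum_\<phi>_le: "sum \<phi> N \<le> 1"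
proof -
  have "(\<Sum>u\<in>N. \<Sum>w\<in>nW u. share w) = (\<Sum>w\<in>W. dN w * share w)"
    by (rule sum_nbr_swap[OF finN finW])
  also have "\<dots> \<le> (\<Sum>w\<in>W. dN w * (1 - x w) + dW w / 2)"
    by (intro sum_mono) (auto simp: share_def field_simps)
  finally show ?thesis using charge_bound by (simp add: \<phi>_def sum.distrib)
qed

text \<open>A vertex w with large \<open>x w\<close> and few neighbours in N needs many in W: the
  eigenvalue equation gives dW w >= l x w - dN w. Hence the share is at least 1/2 - x w + l x w / (2
  dN w), and 1/2 >= x w / 2.\<close>

lemma share_ge:
  assumes w: "w \<in> W" and d: "0 < dN w" and \<kappa>: "\<kappa> \<le> l / (2 * dN w) - 1 / 2"
  shows "\<kappa> * x w \<le> share w"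
proof -
  have "l * x w \<le> dN w + dW w"
  proof -
    have "sum x (nN w) \<le> (\<Sum>u\<in>nN w. 1)" "sum x (nW w) \<le> (\<Sum>u\<in>nW w. 1)"
      by (rule sum_mono, simp add: xN xW)+
    then show ?thesis using eigen_W[OF w] by simp
  qed
  then have "(l * x w - dN w) / (2 * dN w) \<le> dW w / (2 * dN w)"
    using d by (intro divide_right_mono) auto
  moreover have "(l * x w - dN w) / (2 * dN w) = l / (2 * dN w) * x w - 1 / 2"
    using d by (simp add: field_simps)
  moreover have "\<kappa> * x w \<le> (l / (2 * dN w) - 1 / 2) * x w"
    using \<kappa> xW[OF w] by (intro mult_right_mono) auto
  ultimately show ?thesis using xW(2)[OF w] by (simp add: share_def left_diff_distrib)
qed

text \<open>The eigenvalue equation of u turns the weight of its outer neighbours into an expression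
  in \<open>x\<close> on N.\<close>

lemma \<phi>_ge:
  assumes u: "u \<in> N" and sh: "\<And>w. w \<in> nW u \<Longrightarrow> \<kappa> * x w \<le> share w"
  shows "\<phi>0 u + \<kappa> * (l * x u - 1 - sum x (nN u)) \<le> \<phi> u"
proof -
  have "\<kappa> * sum x (nW u) \<le> (\<Sum>w\<in>nW u. share w)"
    unfolding sum_distrib_left using sh by (rule sum_mono)
  then show ?thesis using eigen_N[OF u] by (simp add: \<phi>_def)
qed

lemma sum_nN_closed:
  assumes "closedN H"
  shows "(\<Sum>u\<in>H. sum x (nN u)) = (\<Sum>u\<in>H. dN u * x u)"
proof -
  have "nN u = A u \<inter> H" if "u \<in> H" for u using assms that by (auto simp: closedN_def)
  then show ?thesis using sum_nbr_swap[OF closedN_finite closedN_finite, OF assms assms, of x] by simp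
qed

text \<open>The eigenvalue equation expresses the weight of the outer neighbours of \<open>u\<close> through \<open>x\<close> on \<open>H\<close>; taking
  \<open>\<kappa> = (D - 1) / (l - D)\<close> makes all coefficients of \<open>x\<close> nonnegative.\<close>

lemma charge_bounded_degree:
  assumes H: "closedN H" and D: "\<And>u. u \<in> H \<Longrightarrow> dN u \<le> D" and \<kappa>: "0 \<le> \<kappa>" "D - 1 \<le> \<kappa> * (l - D)"
    and sh: "\<And>u w. u \<in> H \<Longrightarrow> w \<in> nW u \<Longrightarrow> \<kappa> * x w \<le> share w"
  shows "(\<Sum>u\<in>H. dN u) / 2 - \<kappa> * card H \<le> sum \<phi> H"
proof -
  have HN: "H \<subseteq> N" using H by (simp add: closedN_def)
  have "0 \<le> (1 + \<kappa> * l - dN u * (1 + \<kappa>)) * x u" if u: "u \<in> H" for u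
  proof -
    have "dN u * (1 + \<kappa>) \<le> D * (1 + \<kappa>)" using D[OF u] \<kappa> by (intro mult_right_mono) auto
    also have "\<dots> \<le> 1 + \<kappa> * l" using \<kappa> by (simp add: algebra_simps)
    finally show ?thesis using xN(1)[of u] u HN by auto
  qed
  then have "0 \<le> (\<Sum>u\<in>H. (1 + \<kappa> * l - dN u * (1 + \<kappa>)) * x u)" by (rule sum_nonneg)
  also have "\<dots> = (\<Sum>u\<in>H. \<phi>0 u) - (\<Sum>u\<in>H. dN u) / 2 + \<kappa> * card H
      + \<kappa> * ((\<Sum>u\<in>H. l * x u) - card H - (\<Sum>u\<in>H. dN u * x u))"
    by (simp add: \<phi>0_def sum_subtractf sum.distrib sum_divide_distrib[symmetric] sum_distrib_left
        sum_distrib_right algebra_simps)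
  also have "(\<Sum>u\<in>H. \<phi>0 u) - (\<Sum>u\<in>H. dN u) / 2 + \<kappa> * card H
      + \<kappa> * ((\<Sum>u\<in>H. l * x u) - card H - (\<Sum>u\<in>H. dN u * x u))
    = (\<Sum>u\<in>H. \<phi>0 u + \<kappa> * (l * x u - 1 - sum x (nN u))) - (\<Sum>u\<in>H. dN u) / 2 + \<kappa> * card H"
    unfolding sum_nN_closed[OF H, symmetric] by (simp add: sum_subtractf sum.distrib sum_distrib_left[symmetric])
  also have "\<dots> \<le> sum \<phi> H - (\<Sum>u\<in>H. dN u) / 2 + \<kappa> * card H"
  proof -
    have "(\<Sum>u\<in>H. \<phi>0 u + \<kappa> * (l * x u - 1 - sum x (nN u))) \<le> sum \<phi> H"
      by (intro sum_mono \<phi>_ge sh) (use HN in auto)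
    then show ?thesis by simp
  qed
  finally show ?thesis by simp
qed

lemma W_nbrD:
  assumes "w \<in> nW u" shows "w \<in> W" "w \<in> A u" "u \<in> A w"
  using assms A_sym by auto

end

text \<open>\<theta>(1,2,4) is encoded as the 6-cycle a b c d e f with chord ac;
  \<open>l_gt5\<close> comes from m >= 22.\<close>

locale perron_graph_no_theta124 = perron_graph +
  assumes no_theta: "\<lbrakk>distinct [a, b, c, d, e, f]; b \<in> A a; c \<in> A b; d \<in> A c; e \<in> A d; f \<in> A e; a \<in> A f;
      c \<in> A a\<rbrakk> \<Longrightarrow> False"
    and l_gt5: "5 < l"
begin

text \<open>\<open>u0\<close> closes the path to a 6-cycle, with chord from \<open>u0\<close> to
  b.\<close>

lemma no_P5:
  assumes "distinct [a, b, c, d, e]" "{a, b, c, d, e} \<subseteq> N" "b \<in> A a" "c \<in> A b" "d \<in> A c" "e \<in> A d"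
  shows False
proof (rule no_theta[of u0 a b c d e])
  show "distinct [u0, a, b, c, d, e]" using assms(1,2) u0_N by auto
qed (use assms u0_adj in auto)

text \<open>Any other q would close the 6-cycle u0 y z p w q with chord u0 z.\<close>

lemma attach_P3:
  assumes "p \<in> N" "z \<in> nN p" "y \<in> nN z" "p \<noteq> y" "w \<in> nW p" "q \<in> nN w"
  shows "q \<in> {p, z, y}"
proof (rule ccontr)
  assume q: "q \<notin> {p, z, y}"
  show False
  proof (rule no_theta[of u0 y z p w q])
    show "distinct [u0, y, z, p, w, q]"
      using assms q A_irr u0_N u0_W N_W by auto
    show "y \<in> A u0" "z \<in> A u0" "u0 \<in> A q" using assms u0_adj by auto
    show "z \<in> A y" "p \<in> A z" "w \<in> A p" "q \<in> A w" using assms A_sym by auto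
  qed
qed

text \<open>\<open>attach_P3\<close> confines the neighbours of w to {a, b, c}. Being joined to a
  second cycle vertex would put w on a 6-cycle with chord a u0.\<close>

lemma attach_square:
  assumes sq: "distinct [a, b, c, d]" "{a, b, c, d} \<subseteq> N" "b \<in> A a" "c \<in> A b" "d \<in> A c" "a \<in> A d"
    and w: "w \<in> nW a"
  shows "nN w = {a}"
proof -
  have wd: "w \<notin> {u0, a, b, c, d}" using w sq(2) u0_W N_W by auto
  have ud: "u0 \<notin> {a, b, c, d}" using sq(2) u0_N by auto
  have adj: "u0 \<in> A a" "u0 \<in> A b" "u0 \<in> A c" "u0 \<in> A d" "a \<in> A u0" "b \<in> A u0" "c \<in> A u0" "d \<in> A u0"
    using sq(2) u0_adj by auto
  have sym: "a \<in> A b" "b \<in> A c" "c \<in> A d" "d \<in> A a" using sq A_sym by auto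
  have w': "w \<in> A a" "a \<in> A w" using W_nbrD[OF w] by auto
  have nb: "b \<notin> A w"
  proof
    assume h: "b \<in> A w"
    then have "w \<in> A b" using A_sym by blast
    then show False
      using no_theta[of a d u0 c b w] sq adj sym w' wd ud by auto
  qed
  have nd: "d \<notin> A w"
  proof
    assume h: "d \<in> A w"
    then have "w \<in> A d" using A_sym by blast
    then show False
      using no_theta[of a b u0 c d w] sq adj sym w' wd ud by auto
  qed
  have nc: "c \<notin> A w"
  proof
    assume h: "c \<in> A w"
    then have "w \<in> A c" using A_sym by blast
    then show False
      using no_theta[of a b u0 d c w] sq adj sym w' wd ud by auto
  qed
  have "q = a" if q: "q \<in> nN w" for q
    using attach_P3[of a b c w q] sq w q nb nc by auto
  then show ?thesis using w' sq(2) by auto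
qed

text \<open>Each outer neighbour sees a single cycle vertex, so its share is large. With a chord the
  degree sum is at least 10 and the charge at least 5 - 8 / (l - 3), which exceeds 1 exactly when l
  > 5; without one the charge is at least 4 - 4 / (l - 2).\<close>

lemma square_charge:
  assumes sq: "distinct [a, b, c, d]" "{a, b, c, d} \<subseteq> N" "b \<in> A a" "c \<in> A b" "d \<in> A c" "a \<in> A d"
    and H: "closedN {a, b, c, d}"
  shows "1 < sum \<phi> {a, b, c, d}"
proof -
  let ?H = "{a, b, c, d}"
  have cH: "card ?H = 4" using sq(1) by simp
  have single: "nN w = {u}" if "u \<in> ?H" "w \<in> nW u" for u w
    using that attach_square[of a b c d w] attach_square[of b c d a w] attach_square[of c d a b w]
      attach_square[of d a b c w] sq by auto
  have share: "\<kappa> * x w \<le> share w" if "u \<in> ?H" "w \<in> nW u" "\<kappa> \<le> 1" for u w \<kappa>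
    by (rule share_ge) (use that single[OF that(1,2)] l_gt5 in auto)
  have sub: "nN u \<subseteq> ?H - {u}" if "u \<in> ?H" for u using H that A_irr[of u] unfolding closedN_def by blast
  have sup: "{b, d} \<subseteq> nN a" "{a, c} \<subseteq> nN b" "{b, d} \<subseteq> nN c" "{a, c} \<subseteq> nN d"
    using sq A_sym by auto
  have ge2: "2 \<le> card (nN a)" "2 \<le> card (nN b)" "2 \<le> card (nN c)" "2 \<le> card (nN d)"
    using card_mono[OF _ sup(1)] card_mono[OF _ sup(2)] card_mono[OF _ sup(3)] card_mono[OF _ sup(4)] sq(1) finA
    by simp_all
  have sumH: "(\<Sum>u\<in>?H. dN u) = dN a + dN b + dN c + dN d" using sq(1) by simp
  show ?thesis
  proof (cases "c \<in> A a \<or> d \<in> A b")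
    case True
    have "10 \<le> (\<Sum>u\<in>?H. dN u)"
    proof -
      have "3 \<le> card (nN a) \<and> 3 \<le> card (nN c)" if "c \<in> A a"
      proof -
        have "{b, c, d} \<subseteq> nN a" "{a, b, d} \<subseteq> nN c" using that sup sq A_sym by auto
        then show ?thesis using card_mono[of "nN a" "{b, c, d}"] card_mono[of "nN c" "{a, b, d}"] sq(1) finA by simp
      qed
      moreover have "3 \<le> card (nN b) \<and> 3 \<le> card (nN d)" if "d \<in> A b"
      proof -
        have "{a, c, d} \<subseteq> nN b" "{a, b, c} \<subseteq> nN d" using that sup sq A_sym by auto
        then show ?thesis using card_mono[of "nN b" "{a, c, d}"] card_mono[of "nN d" "{a, b, c}"] sq(1) finA by simp
      qed
      ultimately have "10 \<le> card (nN a) + card (nN b) + card (nN c) + card (nN d)" using True ge2 by linarith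
      then show ?thesis unfolding sumH by linarith
    qed
    moreover have "(\<Sum>u\<in>?H. dN u) / 2 - 2 / (l - 3) * card ?H \<le> sum \<phi> ?H"
    proof (rule charge_bounded_degree[OF H])
      show "dN u \<le> 3" if "u \<in> ?H" for u
        using card_mono[OF _ sub[OF that]] that cH by simp
      show "2 / (l - 3) * x w \<le> share w" if "u \<in> ?H" "w \<in> nW u" for u w
        using that l_gt5 by (intro share[of u]) auto
    qed (use l_gt5 in \<open>auto simp: field_simps\<close>)
    moreover have "8 / (l - 3) < 4" using l_gt5 by (simp add: field_simps)
    ultimately show ?thesis unfolding cH by (simp add: field_simps)
  next
    case False
    then have no: "c \<notin> A a" "d \<notin> A b" "a \<notin> A c" "b \<notin> A d" using A_sym by auto
    have d2: "nN u \<subseteq> {b, d} \<or> nN u \<subseteq> {a, c}" if "u \<in> ?H" for u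
      using that no sub[of a] sub[of b] sub[of c] sub[of d] by blast
    have "8 \<le> (\<Sum>u\<in>?H. dN u)" unfolding sumH using ge2 by linarith
    moreover have "(\<Sum>u\<in>?H. dN u) / 2 - 1 / (l - 2) * card ?H \<le> sum \<phi> ?H"
    proof (rule charge_bounded_degree[OF H])
      show "dN u \<le> 2" if "u \<in> ?H" for u
        using d2[OF that] card_mono[of "{b, d}" "nN u"] card_mono[of "{a, c}" "nN u"] sq(1) by auto
      show "1 / (l - 2) * x w \<le> share w" if "u \<in> ?H" "w \<in> nW u" for u w
        using that l_gt5 by (intro share[of u]) auto
    qed (use l_gt5 in auto)
    moreover have "4 / (l - 2) < 3" using l_gt5 by (simp add: field_simps)
    ultimately show ?thesis unfolding cH by (simp add: field_simps)
  qed
qed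

text \<open>An outer vertex may see all three vertices, so its share is estimated with dN w <= 3;
  the charge is still at least 3 - 3 / (l - 2).\<close>

lemma triangle_charge:
  assumes tri: "distinct [v, a, b]" "{v, a, b} \<subseteq> N" "nN v = {a, b}" "nN a = {v, b}" "nN b = {v, a}"
  shows "1 < sum \<phi> {v, a, b}"
proof -
  let ?H = "{v, a, b}"
  have H: "closedN ?H" using tri by (auto simp: closedN_def)
  have cH: "card ?H = 3" using tri(1) by simp
  have att: "nN w \<subseteq> ?H" if "u \<in> ?H" "w \<in> nW u" for u w
  proof
    fix q assume q: "q \<in> nN w"
    consider "u = v" | "u = a" | "u = b" using \<open>u \<in> ?H\<close> by blast
    then show "q \<in> ?H"
    proof cases
      case 1
      have "q \<in> {v, a, b}" by (rule attach_P3[of v a b w q]) (use 1 tri that q in auto)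
      then show ?thesis .
    next
      case 2
      have "q \<in> {a, v, b}" by (rule attach_P3[of a v b w q]) (use 2 tri that q in auto)
      then show ?thesis by blast
    next
      case 3
      have "q \<in> {b, v, a}" by (rule attach_P3[of b v a w q]) (use 3 tri that q in auto)
      then show ?thesis by blast
    qed
  qed
  have share: "1 / (l - 2) * x w \<le> share w" if "u \<in> ?H" "w \<in> nW u" for u w
  proof -
    have "u \<in> nN w" using that tri(2) A_sym by auto
    then have d0: "0 < dN w" using finA[of w] by (auto simp: card_gt_0_iff)
    have "dN w \<le> 3" using card_mono[OF _ att[OF that]] cH by simp
    then have "l / 6 \<le> l / (2 * dN w)" using l_gt5 d0 by (intro divide_left_mono) auto
    moreover have "1 / (l - 2) \<le> 1 / 3" using l_gt5 by (simp add: field_simps)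
    ultimately have "1 / (l - 2) \<le> l / (2 * dN w) - 1 / 2" using l_gt5 by linarith
    then show ?thesis using that d0 by (intro share_ge) auto
  qed
  have "(\<Sum>u\<in>?H. dN u) / 2 - 1 / (l - 2) * card ?H \<le> sum \<phi> ?H"
  proof (rule charge_bounded_degree[OF H])
    show "dN u \<le> 2" if "u \<in> ?H" for u using that tri(3-5) by (auto simp: card_insert_if)
  qed (use l_gt5 share in auto)
  moreover have "(\<Sum>u\<in>?H. dN u) = 6" using tri(1,3-5) by simp
  moreover have "3 / (l - 2) < 2" using l_gt5 by (simp add: field_simps)
  ultimately show ?thesis unfolding cH by (simp add: field_simps)
qed

text \<open>Two applications of \<open>attach_P3\<close> leave only a and v as neighbours; if w were
  joined to v, the 6-cycle a w v p u0 b would have the chord a v.\<close>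

lemma attach_triangle_pendant:
  assumes tri: "distinct [v, a, b]" "{v, a, b} \<subseteq> N" "b \<in> A a" "a \<in> A v" "b \<in> A v"
    and p: "p \<in> nN v" "p \<notin> {a, b}" and w: "w \<in> nW a"
  shows "nN w = {a}"
proof -
  have vN: "v \<notin> A w"
  proof
    assume "v \<in> A w"
    then show False
      using no_theta[of a w v p u0 b] tri p w A_sym u0_adj A_irr[of v] u0_N u0_W N_W by auto
  qed
  have "q = a" if q: "q \<in> nN w" for q
  proof -
    have "q \<in> {a, v, p}" by (rule attach_P3[of a v p w q]) (use tri p w q A_sym in auto)
    moreover have "q \<in> {a, b, v}" by (rule attach_P3[of a b v w q]) (use tri p w q A_sym in auto)
    ultimately show ?thesis using vN p q by auto
  qed
  then show ?thesis using w tri(2) A_sym by auto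
qed

text \<open>v and the leaves are charged by \<open>\<phi>0\<close> alone, together at least (card L
  + 1)(1 - x v) >= 0. The excess over 1 comes from a and b, each of whose outer neighbours sees
  nothing else in N.\<close>

lemma triangle_pendant_charge:
  assumes tri: "distinct [v, a, b]" "insert v (insert a (insert b L)) \<subseteq> N" "a \<notin> L" "b \<notin> L" "v \<notin> L"
        "nN v = insert a (insert b L)" "nN a = {v, b}" "nN b = {v, a}" "\<And>u. u \<in> L \<Longrightarrow> nN u = {v}"
    and L: "L \<noteq> {}"
  shows "1 < sum \<phi> (insert v (insert a (insert b L)))"
proof -
  have fL: "finite L" using tri(2) finN finite_subset by auto
  obtain p where p: "p \<in> L" using L by blast
  have single: "nN w = {u}" if "(u = a \<or> u = b)" "w \<in> nW u" for u w
  proof -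
    have adj: "b \<in> A a" "a \<in> A b" "a \<in> A v" "b \<in> A v" "p \<in> nN v" using tri(6-8) p by auto
    have "nN w = {a}" if "w \<in> nW a"
      by (rule attach_triangle_pendant[of v a b p]) (use tri(1-5) adj p that in auto)
    moreover have "nN w = {b}" if "w \<in> nW b"
      by (rule attach_triangle_pendant[of v b a p]) (use tri(1-5) adj p that in auto)
    ultimately show ?thesis using that by auto
  qed
  \<comment> \<open>This value cancels the coefficients of x a and x b; as l > 5 makes it less than
    1/4, a and b together exceed 1 even if x v = 1.\<close>
  define \<kappa> where "\<kappa> = 1 / (l - 1)"
  have \<kappa>: "0 < \<kappa>" "\<kappa> < 1 / 4" "\<kappa> * (l - 1) = 1" using l_gt5 by (auto simp: \<kappa>_def field_simps)
  have share: "\<kappa> * x w \<le> share w" if "(u = a \<or> u = b)" "w \<in> nW u" for u w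
    by (rule share_ge) (use that single[OF that] l_gt5 \<kappa> in auto)
  have "\<phi>0 a + \<kappa> * (l * x a - 1 - sum x (nN a)) \<le> \<phi> a"
    by (rule \<phi>_ge) (use tri(2) share in auto)
  then have ga: "1 - x a + \<kappa> * (l * x a - 1 - x v - x b) \<le> \<phi> a"
    using tri(1,7) by (simp add: \<phi>0_def algebra_simps)
  have "\<phi>0 b + \<kappa> * (l * x b - 1 - sum x (nN b)) \<le> \<phi> b"
    by (rule \<phi>_ge) (use tri(2) share in auto)
  then have gb: "1 - x b + \<kappa> * (l * x b - 1 - x v - x a) \<le> \<phi> b"
    using tri(1,8) by (simp add: \<phi>0_def algebra_simps)
  have "(1 - x a + \<kappa> * (l * x a - 1 - x v - x b)) + (1 - x b + \<kappa> * (l * x b - 1 - x v - x a))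
    = 2 - x a - x b + (\<kappa> * (l - 1)) * (x a + x b) - 2 * \<kappa> * (1 + x v)"
    by (simp add: algebra_simps)
  then have gab: "2 - 2 * \<kappa> * (1 + x v) \<le> \<phi> a + \<phi> b" using ga gb \<kappa>(3) by simp
  have "card (nN v) = card L + 2" using tri(1,3,4,6) fL by simp
  then have gv: "(card L + 2) / 2 - (card L + 1) * x v \<le> \<phi> v"
    using \<phi>0_le[of v] by (simp add: \<phi>0_def)
  have "(\<Sum>u\<in>L. 1 / 2) \<le> sum \<phi> L"
  proof (rule sum_mono)
    fix u assume "u \<in> L"
    then show "1 / 2 \<le> \<phi> u" using \<phi>0_le[of u] tri(9)[of u] by (simp add: \<phi>0_def)
  qed
  then have gL: "card L / 2 \<le> sum \<phi> L" by simp
  have "x v \<le> 1" using tri(2) xN by auto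
  then have "0 \<le> (card L + 1) * (1 - x v)" "\<kappa> * (1 + x v) \<le> \<kappa> * 2"
    using \<kappa>(1) by (auto intro!: mult_left_mono)
  moreover have "sum \<phi> (insert v (insert a (insert b L))) = \<phi> v + (\<phi> a + \<phi> b + sum \<phi> L)"
    using tri(1,3-5) fL by simp
  ultimately show ?thesis using gab gv gL \<kappa>(2) by (simp add: algebra_simps)
qed

lemma star_if_no_theta: "\<exists>p\<in>N. V = insert u0 N \<and> nN p = N - {p} \<and> (\<forall>u\<in>N - {p}. nN u = {p})"
proof -
  have parts: "(\<exists>v\<in>C. nN v = {}) \<or> (\<exists>H\<subseteq>C. treeN H) \<or> (\<exists>H\<subseteq>C. closedN H \<and> 1 < sum \<phi> H)"
    if C: "closedN C" "C \<noteq> {}" for C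
    using C no_P5
  proof (rule component_cases)
    fix a b c d assume h: "distinct [a, b, c, d]" "{a, b, c, d} \<subseteq> C"
        "b \<in> A a" "c \<in> A b" "d \<in> A c" "a \<in> A d" "closedN {a, b, c, d}"
    have "{a, b, c, d} \<subseteq> N" using h(7) by (simp add: closedN_def)
    then show ?thesis using square_charge[of a b c d] h by blast
  next
    fix v a b L assume h: "distinct [v, a, b]" "insert v (insert a (insert b L)) \<subseteq> C" "a \<notin> L" "b \<notin> L" "v \<notin> L"
        "nN v = insert a (insert b L)" "nN a = {v, b}" "nN b = {v, a}" "\<And>l. l \<in> L \<Longrightarrow> nN l = {v}"
    have sub: "insert v (insert a (insert b L)) \<subseteq> N" using h(2) C by (auto simp: closedN_def)
    have "nN u \<subseteq> insert v (insert a (insert b L))" if u: "u \<in> insert v (insert a (insert b L))" for u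
    proof -
      consider "u = v" | "u = a" | "u = b" | "u \<in> L" using u by blast
      then show ?thesis using h(6-8) h(9)[of u] by cases auto
    qed
    then have "closedN (insert v (insert a (insert b L)))"
      using sub unfolding closedN_def by blast
    moreover have "1 < sum \<phi> (insert v (insert a (insert b L)))"
    proof (cases "L = {}")
      case True
      then show ?thesis using triangle_charge[of v a b] h sub by simp
    next
      case False
      show ?thesis by (rule triangle_pendant_charge[OF h(1) sub h(3-9) False])
    qed
    ultimately show ?thesis using h(2) by blast
  qed blast+
  have nonneg: "0 \<le> sum \<phi> C" if "closedN C" for C
  proof (rule closedN_sum_nonneg[OF _ that])
    fix C assume C: "closedN C" "C \<noteq> {}"
    have CN: "C \<subseteq> N" using C by (simp add: closedN_def)
    consider v where "v \<in> C" "nN v = {}" | H where "H \<subseteq> C" "treeN H" | H where "H \<subseteq> C" "closedN H" "1 < sum \<phi> H"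
      using parts[OF C] by blast
    then show "\<exists>H\<subseteq>C. closedN H \<and> H \<noteq> {} \<and> 0 \<le> sum \<phi> H"
    proof cases
      case (1 v)
      then have "0 \<le> sum \<phi> {v}" using isolated_charge[of v] \<phi>0_le[of v] xN(1)[of v] CN by auto
      then show ?thesis using 1 isolated_closed[of v] CN by (intro exI[of _ "{v}"]) auto
    next
      case (2 H)
      have "sum \<phi>0 H \<le> sum \<phi> H" by (intro sum_mono \<phi>0_le)
      then show ?thesis using 2 tree_charge(1)[of H] by (intro exI[of _ H]) (auto simp: treeN_def)
    next
      case (3 H)
      then show ?thesis by (intro exI[of _ H]) auto
    qed
  qed
  show ?thesis
  proof (rule star_if_forest)
    show "(\<exists>v\<in>C. nN v = {}) \<or> (\<exists>H\<subseteq>C. treeN H)" if C: "closedN C" "C \<noteq> {}" for C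
    proof (rule ccontr)
      assume "\<not> ?thesis"
      \<comment> \<open>A closed part of charge above 1 exceeds the whole budget, as the rest of N
        has nonnegative charge.\<close>
      then obtain H where H: "closedN H" "1 < sum \<phi> H" using parts[OF C] by blast
      then have "0 \<le> sum \<phi> (N - H)" using nonneg closedN_Diff closedN_N by blast
      then show False
        using sum.subset_diff[OF _ finN, of H \<phi>] H sum_\<phi>_le by (simp add: closedN_def)
    qed
    \<comment> \<open>The 6-cycle u0 a p b w c has the chord u0 p.\<close>
    show False if "distinct [a, p, b, c]" "{a, p, b, c} \<subseteq> N" "p \<in> A a" "b \<in> A p" "w \<in> W" "N \<subseteq> A w" for a p b c w
    proof (rule no_theta[of u0 a p b w c])
      show "distinct [u0, a, p, b, w, c]" using that u0_N u0_W N_W by auto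
      show "w \<in> A b" "c \<in> A w" "u0 \<in> A c" "a \<in> A u0" "p \<in> A u0" using that A_sym[of w b] u0_adj by auto
    qed (use that in auto)
  qed
qed

end

section \<open>The case r = 3\<close>

text \<open>In the next two lemmas, eliminating \<open>n\<close> and \<open>Y\<close> leaves a quadratic inequality in \<open>S\<close> with negative
  discriminant.\<close>

lemma no_triangle_arith_far:
  fixes l S Y n :: real
  assumes "3 < l" "9 < l\<^sup>2 - l" "(l - 2) * S - 3 = n - Y" "2 + Y \<le> S" "n * (S - 1) \<le> l * Y" "S \<le> 3" "0 \<le> Y"
  shows False
proof -
  have "Y * (l - S + 1) \<le> (S - 2) * (l - S + 1)" using assms by (intro mult_right_mono) auto
  moreover have n: "n = (l - 2) * S - 3 + Y" using assms by simp
  ultimately have "(l - 1) * S\<^sup>2 - (2 * l + 4) * S + (2 * l + 5) \<le> 0"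
    using assms(5) unfolding n by (simp add: algebra_simps power2_eq_square)
  then have "(l - 1) * ((l - 1) * S\<^sup>2 - (2 * l + 4) * S + (2 * l + 5)) \<le> 0"
    using assms(1) by (simp add: mult_le_0_iff)
  moreover have "(l - 1) * ((l - 1) * S\<^sup>2 - (2 * l + 4) * S + (2 * l + 5)) = ((l - 1) * S - (l + 2))\<^sup>2 + (l\<^sup>2 - l - 9)"
    by (simp add: algebra_simps power2_eq_square)
  ultimately show False using assms(2) zero_le_power2[of "(l - 1) * S - (l + 2)"] by linarith
qed

lemma no_triangle_arith_near:
  fixes l S Y n :: real
  assumes "3 < l" "7 \<le> l\<^sup>2 - l" "(l - 2) * S - 3 = n - Y" "l + 2 + Y \<le> 2 * S" "n * (S - 1) \<le> l * Y" "S \<le> 3" "0 \<le> Y"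
  shows False
proof -
  \<comment> \<open>25/8 is the zero of 28 l - 20 l - 25, the constant term left at the end once
    \<open>l\<^sup>2 - l\<close> is replaced by 7.\<close>
  have l: "25 / 8 < l"
  proof (rule ccontr)
    assume "\<not> ?thesis"
    then have "l * (l - 1) \<le> 25 / 8 * (17 / 8)" using assms(1) by (intro mult_mono) auto
    then show False using assms(2) by (simp add: power2_eq_square algebra_simps)
  qed
  have "Y * (l - S + 1) \<le> (2 * S - 2 - l) * (l - S + 1)" using assms by (intro mult_right_mono) auto
  moreover have n: "n = (l - 2) * S - 3 + Y" using assms by simp
  ultimately have "l * S\<^sup>2 - (4 * l + 5) * S + (l\<^sup>2 + 3 * l + 5) \<le> 0"
    using assms(5) unfolding n by (simp add: algebra_simps power2_eq_square)
  then have "4 * l * (l * S\<^sup>2 - (4 * l + 5) * S + (l\<^sup>2 + 3 * l + 5)) \<le> 0"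
    using assms(1) by (simp add: mult_le_0_iff)
  moreover have "4 * l * (l * S\<^sup>2 - (4 * l + 5) * S + (l\<^sup>2 + 3 * l + 5))
      = (2 * l * S - (4 * l + 5))\<^sup>2 + (4 * l * (l\<^sup>2 - l) - 20 * l - 25)"
    by (simp add: algebra_simps power2_eq_square power3_eq_cube)
  moreover have "4 * l * 7 \<le> 4 * l * (l\<^sup>2 - l)" using assms by (intro mult_left_mono) auto
  ultimately show False using l zero_le_power2[of "2 * l * S - (4 * l + 5)"] by linarith
qed

text \<open>\<theta>(1,2,3) is encoded as the 5-cycle a b c d e with chord ac; \<open>l_ge\<close>
  comes from m >= 8.\<close>

locale perron_graph_no_theta123 = perron_graph +
  assumes no_theta: "\<lbrakk>distinct [a, b, c, d, e]; b \<in> A a; c \<in> A b; d \<in> A c; e \<in> A d; a \<in> A e; c \<in> A a\<rbrakk> \<Longrightarrow> False"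
    and l_ge: "7 \<le> l\<^sup>2 - l"
begin

lemma no_P4:
  assumes "distinct [a, b, c, d]" "{a, b, c, d} \<subseteq> N" "b \<in> A a" "c \<in> A b" "d \<in> A c"
  shows False
proof (rule no_theta[of u0 a b c d])
  show "distinct [u0, a, b, c, d]" using assms(1,2) u0_N by auto
qed (use assms u0_adj in auto)

definition triN where
  "triN v a b \<longleftrightarrow> distinct [v, a, b] \<and> {v, a, b} \<subseteq> N \<and> nN v = {a, b} \<and> nN a = {v, b} \<and> nN b = {v, a}"

lemma triN_closed: "triN v a b \<Longrightarrow> closedN {v, a, b}"
  by (auto simp: triN_def closedN_def)

lemma triN_charge: "triN v a b \<Longrightarrow> sum \<phi>0 {v, a, b} = 3 - sum x {v, a, b}"
  by (simp add: triN_def \<phi>0_def)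

lemma triN_sum_le: "triN v a b \<Longrightarrow> sum x {v, a, b} \<le> 3"
  using xN(2)[of v] xN(2)[of a] xN(2)[of b] by (simp add: triN_def)

text \<open>A 4-cycle and a triangle with a pendant edge both contain a path on four vertices, so
  the bare triangle is the only cyclic component left.\<close>

lemma closedN_parts:
  assumes C: "closedN C" "C \<noteq> {}"
  shows "(\<exists>v\<in>C. nN v = {}) \<or> (\<exists>H\<subseteq>C. treeN H) \<or> (\<exists>v a b. {v, a, b} \<subseteq> C \<and> triN v a b)"
proof -
  have P5: False if "distinct [a, b, c, d, e]" "{a, b, c, d, e} \<subseteq> N" "b \<in> A a" "c \<in> A b" "d \<in> A c" "e \<in> A d" for a b c d e
    using no_P4[of a b c d] that by simp
  have CN: "C \<subseteq> N" using C by (simp add: closedN_def)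
  from C P5 show ?thesis
  proof (rule component_cases)
    fix a b c d assume h: "distinct [a, b, c, d]" "{a, b, c, d} \<subseteq> C" "b \<in> A a" "c \<in> A b" "d \<in> A c"
    have "{a, b, c, d} \<subseteq> N" using h(2) CN by auto
    then show ?thesis using no_P4[of a b c d] h by simp
  next
    fix v a b L assume h: "distinct [v, a, b]" "insert v (insert a (insert b L)) \<subseteq> C" "a \<notin> L" "b \<notin> L" "v \<notin> L"
        "nN v = insert a (insert b L)" "nN a = {v, b}" "nN b = {v, a}" "\<And>l. l \<in> L \<Longrightarrow> nN l = {v}"
    have "L = {}"
    proof (rule ccontr)
      assume "L \<noteq> {}"
      then obtain p where p: "p \<in> L" by blast
      show False
      proof (rule no_P4[of p v a b])
        show "v \<in> A p" using h(9)[OF p] by blast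
        show "a \<in> A v" "b \<in> A a" using h(6,7) by blast+
      qed (use h(1-5) p CN in auto)
    qed
    then have "{v, a, b} \<subseteq> C \<and> triN v a b" using h(1,2,6-8) CN by (auto simp: triN_def)
    then show ?thesis by blast
  qed blast+
qed

lemma \<phi>0_nonneg: "closedN C \<Longrightarrow> 0 \<le> sum \<phi>0 C"
proof (erule closedN_sum_nonneg[rotated])
  fix C assume C: "closedN C" "C \<noteq> {}"
  have CN: "C \<subseteq> N" using C by (simp add: closedN_def)
  consider v where "v \<in> C" "nN v = {}" | H where "H \<subseteq> C" "treeN H" | v a b where "{v, a, b} \<subseteq> C" "triN v a b"
    using closedN_parts[OF C] by blast
  then show "\<exists>H\<subseteq>C. closedN H \<and> H \<noteq> {} \<and> 0 \<le> sum \<phi>0 H"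
  proof cases
    case (1 v)
    then have "0 \<le> sum \<phi>0 {v}" using isolated_charge[of v] xN(1)[of v] CN by auto
    then show ?thesis using 1 isolated_closed[of v] CN by (intro exI[of _ "{v}"]) auto
  next
    case (2 H)
    then show ?thesis using tree_charge(1)[of H] by (intro exI[of _ H]) (auto simp: treeN_def)
  next
    case (3 v a b)
    then have "0 \<le> sum \<phi>0 {v, a, b}" using triN_charge[of v a b] triN_sum_le[of v a b] by linarith
    then show ?thesis using 3 triN_closed[of v a b] by (intro exI[of _ "{v, a, b}"]) auto
  qed
qed

text \<open>If w were joined to v and a, the 5-cycle a w v b u0 would have the chord a v.\<close>

lemma attach_triangle:
  assumes tri: "triN v a b" and w: "w \<in> W" "v \<in> A w"
  shows "a \<notin> A w" "b \<notin> A w"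
proof -
  have t: "distinct [v, a, b]" "v \<in> N" "a \<in> N" "b \<in> N" "nN v = {a, b}" "nN a = {v, b}" "nN b = {v, a}"
    using tri by (simp_all add: triN_def)
  have adj: "a \<in> A v" "b \<in> A v" "v \<in> A a" "b \<in> A a" "v \<in> A b" "a \<in> A b" "w \<in> A v"
    using t(5-7) A_sym w(2) by blast+
  note u0s = u0_adj[OF t(3)] u0_adj[OF t(4)]
  have d: "w \<notin> {v, a, b, u0}" "u0 \<notin> {v, a, b}" using t(2-4) w(1) N_W u0_N u0_W by auto
  show "a \<notin> A w"
  proof
    assume "a \<in> A w"
    then have "w \<in> A a" using A_sym by blast
    then show False
      using no_theta[of a w v b u0] w(2) t(1) adj u0s d by auto
  qed
  show "b \<notin> A w"
  proof
    assume "b \<in> A w"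
    then have "w \<in> A b" using A_sym by blast
    then show False
      using no_theta[of b w v a u0] w(2) t(1) adj u0s d by auto
  qed
qed

lemma triN_rotate: "triN v a b \<Longrightarrow> triN a b v"
  by (auto simp: triN_def)

text \<open>The triangle has charge 3 - S, so the budget forces S >= 2. Then \<open>balance\<close>
  demands much weight on outer neighbours, while each of these misses two triangle vertices and so
  falls short of 1 (\<open>gap\<close>). The total shortfall Y is charged as well, and these demands
  are incompatible.\<close>

lemma no_triangle:
  assumes tri: "triN v a b"
  shows False
proof -
  define T where "T = {v, a, b}"
  define S where "S = sum x T"
  define WT where "WT = {w\<in>W. A w \<inter> T \<noteq> {}}"
  define n where "n = real (card WT)"
  define Y where "Y = (\<Sum>w\<in>WT. 1 - x w)"
  define e where "e = (\<Sum>w\<in>W. dW w) / 2"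
  define R where "R = sum \<phi>0 (N - T)"
  have T: "closedN T" "T \<subseteq> N" "finite T" "card T = 3" using triN_closed[OF tri] tri by (auto simp: T_def closedN_def triN_def)
  have WT: "WT \<subseteq> W" "finite WT" using finW by (auto simp: WT_def)
  have one: "card (A w \<inter> T) = 1" if w: "w \<in> WT" for w
  proof -
    obtain t where t: "t \<in> A w" "t \<in> T" using w by (auto simp: WT_def)
    have wW: "w \<in> W" using w WT by blast
    have att: "v \<in> A w \<Longrightarrow> a \<notin> A w \<and> b \<notin> A w" "a \<in> A w \<Longrightarrow> b \<notin> A w \<and> v \<notin> A w" "b \<in> A w \<Longrightarrow> v \<notin> A w \<and> a \<notin> A w"
      using attach_triangle[OF tri wW] attach_triangle[OF triN_rotate[OF tri] wW]
        attach_triangle[OF triN_rotate[OF triN_rotate[OF tri]] wW] by blast+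
    have "A w \<inter> T = {t}" using t att unfolding T_def by blast
    then show ?thesis by simp
  qed
  have S3: "S \<le> 3" using triN_sum_le[OF tri] by (simp add: S_def T_def)
  have R0: "0 \<le> R" unfolding R_def by (intro \<phi>0_nonneg closedN_Diff closedN_N T)
  have Y0: "0 \<le> Y" unfolding Y_def using WT xW by (intro sum_nonneg) auto
  \<comment> \<open>Sum of the eigenvalue equations over T; by \<open>one\<close> each vertex of
    \<open>WT\<close> is counted once.\<close>
  have balance: "(l - 2) * S - 3 = n - Y"
  proof -
    have "l * S = (\<Sum>u\<in>T. 1 + sum x (nN u) + sum x (nW u))"
      unfolding S_def sum_distrib_left using eigen_N T(2) by (intro sum.cong) auto
    also have "\<dots> = 3 + (\<Sum>u\<in>T. sum x (nN u)) + (\<Sum>u\<in>T. sum x (nW u))"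
      using T(4) by (simp add: sum.distrib)
    also have "(\<Sum>u\<in>T. sum x (nN u)) = 2 * S"
      using tri by (auto simp: T_def S_def triN_def)
    also have "(\<Sum>u\<in>T. sum x (nW u)) = (\<Sum>w\<in>W. real (card (A w \<inter> T)) * x w)"
      by (rule sum_nbr_swap[OF T(3) finW])
    also have "\<dots> = (\<Sum>w\<in>WT. real (card (A w \<inter> T)) * x w)"
      by (intro sum.mono_neutral_right) (auto simp: WT_def finW)
    also have "\<dots> = sum x WT" using one by simp
    also have "\<dots> = n - Y" by (simp add: n_def Y_def sum_subtractf)
    finally show ?thesis by (simp add: algebra_simps)
  qed
  have charge: "R + (3 - S) + e + Y \<le> 1"
  proof -
    have "Y \<le> (\<Sum>w\<in>WT. dN w * (1 - x w))" unfolding Y_def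
    proof (rule sum_mono)
      fix w assume w: "w \<in> WT"
      then have "nN w \<noteq> {}" using T(2) by (auto simp: WT_def)
      then have "1 \<le> dN w" using finA[of w] by (simp add: Suc_le_eq card_gt_0_iff)
      moreover have "0 \<le> 1 - x w" using w WT xW(2)[of w] by auto
      ultimately show "1 - x w \<le> dN w * (1 - x w)" using mult_right_mono[of 1 "dN w" "1 - x w"] by simp
    qed
    also have "\<dots> \<le> (\<Sum>w\<in>W. dN w * (1 - x w))"
      using WT finW xW by (intro sum_mono2) auto
    finally have "Y + e \<le> (\<Sum>w\<in>W. dN w * (1 - x w) + dW w / 2)"
      by (simp add: e_def sum.distrib sum_divide_distrib)
    moreover have "sum \<phi>0 N = R + (3 - S)"
      using sum.subset_diff[OF T(2) finN, of \<phi>0] triN_charge[OF tri] by (simp add: R_def S_def T_def)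
    ultimately show ?thesis using charge_bound by linarith
  qed
  have e0: "0 \<le> e" by (simp add: e_def sum_nonneg)
  \<comment> \<open>\<open>e\<close> is the number of edges inside W, and each edge at w is also
    counted at its other end.\<close>
  have dW_le: "dW w \<le> e" if w: "w \<in> W" for w
  proof -
    have "dW w = (\<Sum>u\<in>nW w. 1)" by simp
    also have "\<dots> \<le> (\<Sum>u\<in>nW w. dW u)"
    proof (rule sum_mono)
      fix u assume "u \<in> nW w"
      then have "w \<in> nW u" using w A_sym by blast
      then have "0 < card (nW u)" using finA[of u] card_gt_0_iff by blast
      then show "1 \<le> dW u" by simp
    qed
    also have "\<dots> \<le> (\<Sum>u\<in>W - {w}. dW u)" using finW A_irr[of w] by (intro sum_mono2) auto
    also have "\<dots> = 2 * e - dW w" using sum.remove[OF finW w, of dW] by (simp add: e_def field_simps)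
    finally show ?thesis by simp
  qed
  \<comment> \<open>Subtract the equation of w from that of u0: w misses two vertices of T, of
    weight at least S - 1, and gains at most \<open>e\<close> from W.\<close>
  have gap: "n * (S - 1 - e) \<le> l * Y"
  proof -
    have "S - 1 - e \<le> l * (1 - x w)" if w: "w \<in> WT" for w
    proof -
      have wW: "w \<in> W" using w WT by auto
      obtain t where t: "A w \<inter> T = {t}" using one[OF w] card_1_singletonE by metis
      have tT: "t \<in> T" using t by blast
      have "sum x N = sum x (nN w) + sum x (N - nN w)"
        using sum.subset_diff[of "nN w" N x] finN by simp
      moreover have "sum x (T - {t}) \<le> sum x (N - nN w)"
        using t T(2) finN xN by (intro sum_mono2) auto
      moreover have "sum x T = x t + sum x (T - {t})" by (rule sum.remove[OF T(3) tT])
      moreover have "x t \<le> 1" using tT T(2) xN by auto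
      moreover have "sum x (nW w) \<le> (\<Sum>u\<in>nW w. 1)" using xW by (intro sum_mono) simp
      ultimately show ?thesis
        using eigen_W[OF wW] eigen_u0 dW_le[OF wW] by (simp add: S_def right_diff_distrib)
    qed
    then have "(\<Sum>w\<in>WT. S - 1 - e) \<le> (\<Sum>w\<in>WT. l * (1 - x w))" by (rule sum_mono)
    then show ?thesis by (simp add: n_def Y_def sum_distrib_left)
  qed
  have n0: "0 \<le> n" by (simp add: n_def)
  \<comment> \<open>Charge 1 from outside forces S = 3 and Y = 0; then \<open>gap\<close> gives n =
    0 and \<open>balance\<close> would require l = 3.\<close>
  have tight: False if "1 \<le> R + e"
  proof -
    have h: "S = 3" "Y = 0" "R + e = 1" using that charge S3 Y0 by linarith+
    then have "n * (2 - e) \<le> 0" using gap by simp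
    moreover have "0 < 2 - e" using h R0 by linarith
    ultimately have "n \<le> 0" by (simp add: mult_le_0_iff)
    then show False using balance h n0 l_gt3 by simp
  qed
  have "e = 0"
  proof (rule ccontr)
    assume "e \<noteq> 0"
    then have "(\<Sum>w\<in>W. dW w) \<noteq> 0" by (simp add: e_def)
    then obtain w where w: "w \<in> W" "dW w \<noteq> 0" by (rule sum.not_neutral_contains_not_neutral)
    then have "1 \<le> dW w" by simp
    then show False using tight dW_le[OF w(1)] R0 by linarith
  qed
  then have gap': "n * (S - 1) \<le> l * Y" using gap by simp
  show False
  \<comment> \<open>If N has no edges beyond T, then R = l - S. Otherwise a tree gives R >= 1, and a
    second triangle gives m >= 12: two triangles and the six edges from them to u0.\<close>
  proof (cases "\<forall>u\<in>N - T. nN u = {}")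
    case True
    then have "R = sum x (N - T)" unfolding R_def using isolated_charge by (intro sum.cong) auto
    then have "R = l - S" using sum.subset_diff[OF T(2) finN, of x] eigen_u0 by (simp add: S_def)
    then show False
      using no_triangle_arith_near[OF l_gt3 l_ge balance _ gap' S3 Y0] charge e0 by linarith
  next
    case False
    define C where "C = {u\<in>N - T. nN u \<noteq> {}}"
    have cNT: "closedN (N - T)" by (intro closedN_Diff closedN_N T)
    have C: "closedN C" "C \<noteq> {}"
    proof -
      have "nN u \<subseteq> C" if "u \<in> C" for u
      proof
        fix z assume z: "z \<in> nN u"
        then have "z \<in> N - T" using cNT that unfolding closedN_def C_def by blast
        moreover have "u \<in> nN z" using z that A_sym by (auto simp: C_def)
        ultimately show "z \<in> C" by (auto simp: C_def)
      qed
      then show "closedN C" by (auto simp: closedN_def C_def)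
      show "C \<noteq> {}" using False by (auto simp: C_def)
    qed
    have "(\<exists>H\<subseteq>C. treeN H) \<or> (\<exists>v' a' b'. {v', a', b'} \<subseteq> C \<and> triN v' a' b')"
      using closedN_parts[OF C] by (auto simp: C_def)
    then show False
    proof (elim disjE exE conjE)
      fix H assume H: "H \<subseteq> C" "treeN H"
      have "closedN (N - T - H)" using closedN_Diff[OF cNT] H by (simp add: treeN_def)
      then have "0 \<le> sum \<phi>0 (N - T - H)" by (rule \<phi>0_nonneg)
      moreover have "H \<subseteq> N - T" using H by (auto simp: C_def)
      then have "R = sum \<phi>0 (N - T - H) + sum \<phi>0 H" unfolding R_def using finN by (intro sum.subset_diff) auto
      ultimately show False using tight tree_charge(1)[OF H(2)] e0 by linarith
    next
      fix v' a' b' assume tri': "{v', a', b'} \<subseteq> C" "triN v' a' b'"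
      define U where "U = T \<union> {v', a', b'}"
      have disj: "T \<inter> {v', a', b'} = {}" using tri'(1) by (auto simp: C_def)
      have U: "U \<subseteq> N" "finite U" using T tri'(2) by (auto simp: U_def triN_def)
      have "card U = 6" using disj T(3,4) tri'(2) by (simp add: U_def card_Un_disjoint triN_def)
      then have "6 \<le> card N" using card_mono[OF finN U(1)] by simp
      moreover have "(\<Sum>u\<in>U. dN u) = 12"
      proof -
        have "(\<Sum>u\<in>U. dN u) = (\<Sum>u\<in>T. dN u) + (\<Sum>u\<in>{v', a', b'}. dN u)"
          unfolding U_def using disj T(3) by (intro sum.union_disjoint) auto
        then show ?thesis using tri tri'(2) by (simp add: T_def triN_def)
      qed
      then have "12 \<le> (\<Sum>u\<in>N. dN u)" using sum_mono2[OF finN U(1), of dN] by simp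
      moreover have "0 \<le> (\<Sum>w\<in>W. dN w)" "0 \<le> (\<Sum>w\<in>W. dW w)" by (auto intro: sum_nonneg)
      ultimately have "12 \<le> real m" using edge_count by linarith
      then have "9 < l\<^sup>2 - l" using l_m by linarith
      then show False
        using no_triangle_arith_far[OF l_gt3 _ balance _ gap' S3 Y0] charge e0 R0 by linarith
    qed
  qed
qed

lemma star_if_no_theta: "\<exists>p\<in>N. V = insert u0 N \<and> nN p = N - {p} \<and> (\<forall>u\<in>N - {p}. nN u = {p})"
proof (rule star_if_forest)
  show "(\<exists>v\<in>C. nN v = {}) \<or> (\<exists>H\<subseteq>C. treeN H)" if "closedN C" "C \<noteq> {}" for C
    using closedN_parts[OF that] no_triangle by blast
  \<comment> \<open>The 5-cycle a p u0 b w has the chord a u0.\<close>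
  show False if "distinct [a, p, b, c]" "{a, p, b, c} \<subseteq> N" "p \<in> A a" "b \<in> A p" "w \<in> W" "N \<subseteq> A w" for a p b c w
  proof (rule no_theta[of a p u0 b w])
    show "distinct [a, p, u0, b, w]" using that u0_N u0_W N_W by auto
    show "w \<in> A b" "a \<in> A w" "u0 \<in> A p" "u0 \<in> A a" "b \<in> A u0" using that A_sym[of w b] u0_adj by auto
  qed (use that in auto)
qed

end

section \<open>Theta graphs and complete split graphs\<close>

lemma contains_copyI:
  assumes G: "simple_graph G" and F: "simple_graph F" and inj: "inj_on g (verts F)"
    and V: "g ` verts F \<subseteq> verts G" and E: "image g ` edges F \<subseteq> edges G"
  shows "contains_copy G F"
proof -
  define H where "H = (g ` verts F, image g ` edges F)"
  have eF: "e \<subseteq> verts F" "card e = 2" if "e \<in> edges F" for e using F that by (auto simp: simple_graph_def)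
  have "simple_graph H"
    using F inj by (auto simp: H_def simple_graph_def card_image inj_on_subset)
  then have "subgraph_of H G" using V E by (simp add: subgraph_of_def H_def)
  moreover have "H \<cong>\<^sub>g F"
    unfolding graph_iso_def
  proof (intro exI[of _ "inv_into (verts F) g"] conjI ballI)
    show "bij_betw (inv_into (verts F) g) (verts H) (verts F)"
      using inj by (simp add: H_def bij_betw_inv_into inj_on_imp_bij_betw)
    fix u v assume "u \<in> verts H" "v \<in> verts H"
    then obtain p q where pq: "p \<in> verts F" "q \<in> verts F" "u = g p" "v = g q" by (auto simp: H_def)
    have "{g p, g q} \<in> image g ` edges F \<longleftrightarrow> {p, q} \<in> edges F"
    proof
      assume "{g p, g q} \<in> image g ` edges F"
      then obtain e where e: "e \<in> edges F" "g ` {p, q} = g ` e" by auto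
      then have "{p, q} = e" using inj_on_image_eq_iff[OF inj, of "{p, q}" e] eF pq by auto
      then show "{p, q} \<in> edges F" using e by simp
    next
      assume "{p, q} \<in> edges F"
      then show "{g p, g q} \<in> image g ` edges F" by (intro image_eqI[of _ _ "{p, q}"]) auto
    qed
    then show "{u, v} \<in> edges H \<longleftrightarrow> {inv_into (verts F) g u, inv_into (verts F) g v} \<in> edges F"
      using pq inj by (simp add: H_def inv_into_f_f)
  qed
  ultimately show ?thesis unfolding contains_copy_def by blast
qed

lemma path_edges_Cons: "path_edges (a # b # xs) = insert {a, b} (path_edges (b # xs))"
proof -
  have "path_edges (a # b # xs) = (\<lambda>k. {(a # b # xs) ! k, (a # b # xs) ! Suc k}) ` {..<Suc (length xs)}"
    unfolding path_edges_def by auto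
  also have "\<dots> = insert {a, b} ((\<lambda>k. {(b # xs) ! k, (b # xs) ! Suc k}) ` {..<length xs})"
    by (subst lessThan_Suc_eq_insert_0) (simp add: image_image)
  also have "(\<lambda>k. {(b # xs) ! k, (b # xs) ! Suc k}) ` {..<length xs} = path_edges (b # xs)"
    unfolding path_edges_def by auto
  finally show ?thesis .
qed

lemma path_edges_single: "path_edges [a] = {}"
  by (simp add: path_edges_def)

lemma theta_1_2_3:
  "verts (theta_graph 1 2 3) = {Source, Sink, Inner 1 1, Inner 2 1, Inner 2 2}"
  "edges (theta_graph 1 2 3) = {{Source, Sink}, {Source, Inner 1 1}, {Inner 1 1, Sink},
     {Source, Inner 2 1}, {Inner 2 1, Inner 2 2}, {Inner 2 2, Sink}}"
  by (auto simp: theta_graph_def theta_path_def upt_rec numeral_3_eq_3 numeral_2_eq_2 path_edges_Cons path_edges_single)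

lemma theta_1_2_4:
  "verts (theta_graph 1 2 4) = {Source, Sink, Inner 1 1, Inner 2 1, Inner 2 2, Inner 2 3}"
  "edges (theta_graph 1 2 4) = {{Source, Sink}, {Source, Inner 1 1}, {Inner 1 1, Sink},
     {Source, Inner 2 1}, {Inner 2 1, Inner 2 2}, {Inner 2 2, Inner 2 3}, {Inner 2 3, Sink}}"
  by (auto simp: theta_graph_def theta_path_def upt_rec eval_nat_numeral path_edges_Cons path_edges_single)

text \<open>The three paths from a to c are the chord, a b c and a e d c.\<close>

lemma contains_theta_1_2_3:
  assumes G: "simple_graph G" and d: "distinct [a, b, c, d, e]"
    and nb: "b \<in> nbrs G a" "c \<in> nbrs G b" "d \<in> nbrs G c" "e \<in> nbrs G d" "a \<in> nbrs G e" "c \<in> nbrs G a"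
  shows "contains_copy G (theta_graph 1 2 3)"
proof -
  define g where "g t = (case t of Source \<Rightarrow> a | Sink \<Rightarrow> c
      | Inner i k \<Rightarrow> if i = 1 then b else if k = 1 then e else d)" for t
  have g: "g Source = a" "g Sink = c" "g (Inner 1 1) = b" "g (Inner 2 1) = e" "g (Inner 2 2) = d"
    by (simp_all add: g_def)
  have E: "{a, c} \<in> edges G" "{a, b} \<in> edges G" "{b, c} \<in> edges G" "{a, e} \<in> edges G" "{e, d} \<in> edges G" "{d, c} \<in> edges G"
    using nb by (simp_all add: nbrs_def insert_commute)
  show ?thesis
  proof (rule contains_copyI[OF G])
    show "simple_graph (theta_graph 1 2 3)" unfolding simple_graph_def theta_1_2_3 by simp
    show "inj_on g (verts (theta_graph 1 2 3))"
      unfolding theta_1_2_3 using d by (auto simp: inj_on_def g simp del: One_nat_def)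
    show "image g ` edges (theta_graph 1 2 3) \<subseteq> edges G"
      unfolding theta_1_2_3 using E by (simp add: g del: One_nat_def)
    have "{a, b, c, d, e} \<subseteq> verts G" using nb nbrs_subset[OF G] by blast
    then show "g ` verts (theta_graph 1 2 3) \<subseteq> verts G"
      unfolding theta_1_2_3 by (simp add: g del: One_nat_def)
  qed
qed

lemma contains_theta_1_2_4:
  assumes G: "simple_graph G" and d: "distinct [a, b, c, d, e, f]"
    and nb: "b \<in> nbrs G a" "c \<in> nbrs G b" "d \<in> nbrs G c" "e \<in> nbrs G d" "f \<in> nbrs G e" "a \<in> nbrs G f" "c \<in> nbrs G a"
  shows "contains_copy G (theta_graph 1 2 4)"
proof -
  define g where "g t = (case t of Source \<Rightarrow> a | Sink \<Rightarrow> c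
      | Inner i k \<Rightarrow> if i = 1 then b else if k = 1 then f else if k = 2 then e else d)" for t
  have g: "g Source = a" "g Sink = c" "g (Inner 1 1) = b" "g (Inner 2 1) = f" "g (Inner 2 2) = e" "g (Inner 2 3) = d"
    by (simp_all add: g_def)
  have E: "{a, c} \<in> edges G" "{a, b} \<in> edges G" "{b, c} \<in> edges G" "{a, f} \<in> edges G" "{f, e} \<in> edges G"
      "{e, d} \<in> edges G" "{d, c} \<in> edges G"
    using nb by (simp_all add: nbrs_def insert_commute)
  show ?thesis
  proof (rule contains_copyI[OF G])
    show "simple_graph (theta_graph 1 2 4)" unfolding simple_graph_def theta_1_2_4 by simp
    show "inj_on g (verts (theta_graph 1 2 4))"
      unfolding theta_1_2_4 using d by (auto simp: inj_on_def g simp del: One_nat_def)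
    show "image g ` edges (theta_graph 1 2 4) \<subseteq> edges G"
      unfolding theta_1_2_4 using E by (simp add: g del: One_nat_def)
    have "{a, b, c, d, e, f} \<subseteq> verts G" using nb nbrs_subset[OF G] by blast
    then show "g ` verts (theta_graph 1 2 4) \<subseteq> verts G"
      unfolding theta_1_2_4 by (simp add: g del: One_nat_def)
  qed
qed

section \<open>Degree sums and books\<close>

lemma simple_graph_finite_edges: "simple_graph G \<Longrightarrow> finite (edges G)"
  by (rule finite_subset[of _ "Pow (verts G)"]) (auto simp: simple_graph_def)

lemma handshaking:
  assumes G: "simple_graph G"
  shows "(\<Sum>v\<in>verts G. card (nbrs G v)) = 2 * card (edges G)"
proof -
  have fV: "finite (verts G)" and fE: "finite (edges G)"
    using G simple_graph_finite_edges[OF G] by (auto simp: simple_graph_def)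
  have "card (nbrs G v) = card {e\<in>edges G. v \<in> e}" for v
  proof (rule bij_betw_same_card[of "\<lambda>u. {v, u}"])
    show "bij_betw (\<lambda>u. {v, u}) (nbrs G v) {e\<in>edges G. v \<in> e}"
      unfolding bij_betw_def
    proof
      show "inj_on (\<lambda>u. {v, u}) (nbrs G v)" by (auto simp: inj_on_def doubleton_eq_iff)
      show "(\<lambda>u. {v, u}) ` nbrs G v = {e\<in>edges G. v \<in> e}"
      proof (intro subset_antisym subsetI)
        fix e assume e: "e \<in> {e\<in>edges G. v \<in> e}"
        then have "card e = 2" using G by (auto simp: simple_graph_def)
        then obtain p q where "e = {p, q}" by (auto simp: card_2_iff)
        then obtain u where "e = {v, u}" using e by (auto simp: insert_commute)
        then show "e \<in> (\<lambda>u. {v, u}) ` nbrs G v" using e by (auto simp: nbrs_def)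
      qed (auto simp: nbrs_def)
    qed
  qed
  then have "(\<Sum>v\<in>verts G. card (nbrs G v)) = (\<Sum>v\<in>verts G. card {e\<in>edges G. v \<in> e})" by simp
  also have "\<dots> = 2 * card (edges G)"
  proof (rule sum_multicount[OF fV fE], rule ballI)
    fix e assume "e \<in> edges G"
    then have "e \<subseteq> verts G" "card e = 2" using G by (auto simp: simple_graph_def)
    moreover from this have "{v\<in>verts G. v \<in> e} = e" by auto
    ultimately show "card {v\<in>verts G. v \<in> e} = 2" by simp
  qed
  finally show ?thesis .
qed

text \<open>The complete split graph with k = 2 described inside G, away from the sum and product
  types of its standard copy: ab is the spine, the other vertices are the pages.\<close>

definition book :: "'a ugraph \<Rightarrow> 'a \<Rightarrow> 'a \<Rightarrow> bool" where
  "book G a b \<longleftrightarrow> a \<in> verts G \<and> b \<in> verts G \<and> a \<noteq> b \<and>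
     (\<forall>u\<in>verts G. \<forall>v\<in>verts G. {u, v} \<in> edges G \<longleftrightarrow> u \<noteq> v \<and> (u \<in> {a, b} \<or> v \<in> {a, b}))"

lemma verts_complete_split: "verts (complete_split_graph n 2) = {..<2} <+> ({..<n - 2} \<times> {0})"
  by (auto simp: complete_split_graph_def graph_join_def graph_copies_def complete_graph_def)

lemma complete_split_edge_iff:
  assumes "u \<in> verts (complete_split_graph n 2)" "v \<in> verts (complete_split_graph n 2)"
  shows "{u, v} \<in> edges (complete_split_graph n 2) \<longleftrightarrow> u \<noteq> v \<and> (u \<in> {Inl 0, Inl 1} \<or> v \<in> {Inl 0, Inl 1})"
proof -
  have E: "edges (complete_split_graph n 2) =
     insert {Inl 0, Inl 1} {{Inl i, Inr (j, 0)} | i j. i < 2 \<and> j < n - 2}"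
  proof -
    have e2: "edges (complete_graph 2) = {{0, 1}}"
      by (auto simp: complete_graph_def less_2_cases_iff insert_commute)
    have e1: "edges (complete_graph 1) = {}" by (auto simp: complete_graph_def)
    have v1: "verts (complete_graph 1) = {0}" "verts (complete_graph 2) = {..<2}" by (auto simp: complete_graph_def)
    show ?thesis
      using e1 e2 v1 by (auto simp: complete_split_graph_def graph_join_def graph_copies_def)
  qed
  show ?thesis using assms unfolding E verts_complete_split
    by (auto simp: less_2_cases_iff doubleton_eq_iff)
qed

text \<open>The preimages of the two vertices of K_2 form the spine; they exist for every n, as
  truncated subtraction affects only the pages.\<close>

lemma book_if_iso_split:
  assumes "G \<cong>\<^sub>g complete_split_graph n 2"
  shows "\<exists>a b. book G a b"
proof -
  let ?S = "complete_split_graph n 2"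
  obtain f where f: "bij_betw f (verts G) (verts ?S)"
    and E: "\<And>u v. u \<in> verts G \<Longrightarrow> v \<in> verts G \<Longrightarrow> {u, v} \<in> edges G \<longleftrightarrow> {f u, f v} \<in> edges ?S"
    using assms unfolding graph_iso_def by blast
  have "Inl 0 \<in> verts ?S" "Inl 1 \<in> verts ?S" by (auto simp: verts_complete_split)
  then obtain a b where ab: "a \<in> verts G" "b \<in> verts G" "f a = Inl 0" "f b = Inl 1"
    using f by (metis bij_betw_imp_surj_on imageE)
  have inj: "f u = f v \<longleftrightarrow> u = v" if "u \<in> verts G" "v \<in> verts G" for u v
    using f that by (auto simp: bij_betw_def inj_on_def)
  have fV: "f u \<in> verts ?S" if "u \<in> verts G" for u using f that by (auto simp: bij_betw_def)
  have "book G a b" unfolding book_def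
  proof (intro conjI ballI)
    show "a \<noteq> b" using ab by auto
    fix u v assume uv: "u \<in> verts G" "v \<in> verts G"
    have "{u, v} \<in> edges G \<longleftrightarrow> f u \<noteq> f v \<and> (f u \<in> {f a, f b} \<or> f v \<in> {f a, f b})"
      unfolding E[OF uv] ab(3,4) by (rule complete_split_edge_iff[OF fV fV, OF uv])
    then show "{u, v} \<in> edges G \<longleftrightarrow> u \<noteq> v \<and> (u \<in> {a, b} \<or> v \<in> {a, b})"
      using inj uv ab(1,2) by simp
  qed (use ab in auto)
  then show ?thesis by blast
qed

lemma iso_split_if_book:
  assumes fin: "finite (verts G)" and book: "book G a b"
  shows "G \<cong>\<^sub>g complete_split_graph (card (verts G)) 2"
proof -
  let ?n = "card (verts G)"
  let ?S = "complete_split_graph ?n 2"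
  define L where "L = verts G - {a, b}"
  have ab: "a \<in> verts G" "b \<in> verts G" "a \<noteq> b" using book by (auto simp: book_def)
  have VL: "verts G = insert a (insert b L)" using ab by (auto simp: L_def)
  have abL: "a \<notin> L" "b \<notin> L" by (auto simp: L_def)
  have cL: "card L = ?n - 2" "finite L" using ab fin by (simp_all add: L_def card_Diff_subset)
  then obtain h where h: "bij_betw h L {..<?n - 2}"
    using ex_bij_betw_finite_nat[of L] by (auto simp: atLeast0LessThan)
  define f where "f u = (if u = a then Inl (0 :: nat) else if u = b then Inl 1 else Inr (h u, 0 :: nat))" for u
  have f: "f a = Inl 0" "f b = Inl 1" "\<And>u. u \<in> L \<Longrightarrow> f u = Inr (h u, 0)"
    using ab abL by (auto simp: f_def)
  have bij: "bij_betw f (verts G) (verts ?S)"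
    unfolding bij_betw_def
  proof
    show "inj_on f (verts G)"
      using h f unfolding VL by (auto simp: inj_on_def bij_betw_def f_def)
    have "f ` L = (\<lambda>j. Inr (j, 0)) ` h ` L" unfolding image_image using f(3) by (intro image_cong) auto
    also have "h ` L = {..<?n - 2}" using h by (simp add: bij_betw_def)
    finally have "f ` verts G = insert (Inl 0) (insert (Inl 1) ((\<lambda>j. Inr (j, 0)) ` {..<?n - 2}))"
      by (subst VL) (simp add: f(1,2))
    then show "f ` verts G = verts ?S"
      unfolding verts_complete_split by (auto simp: less_2_cases_iff)
  qed
  have inj: "f u = f v \<longleftrightarrow> u = v" if "u \<in> verts G" "v \<in> verts G" for u v
    using bij that by (auto simp: bij_betw_def inj_on_def)
  have fV: "f u \<in> verts ?S" if "u \<in> verts G" for u using bij that by (auto simp: bij_betw_def)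
  show ?thesis unfolding graph_iso_def
  proof (intro exI[of _ f] conjI ballI bij)
    fix u v assume uv: "u \<in> verts G" "v \<in> verts G"
    have "{f u, f v} \<in> edges ?S \<longleftrightarrow> f u \<noteq> f v \<and> (f u \<in> {f a, f b} \<or> f v \<in> {f a, f b})"
      unfolding f(1,2) by (rule complete_split_edge_iff[OF fV fV, OF uv])
    then show "{u, v} \<in> edges G \<longleftrightarrow> {f u, f v} \<in> edges ?S"
      using inj uv ab book unfolding book_def by simp
  qed
qed

lemma nbrs_book:
  assumes G: "simple_graph G" and book: "book G a b"
  shows "nbrs G a = verts G - {a}" "nbrs G b = verts G - {b}" "v \<in> verts G - {a, b} \<Longrightarrow> nbrs G v = {a, b}"
proof -
  have iff: "u \<in> nbrs G v \<longleftrightarrow> u \<in> verts G \<and> u \<noteq> v \<and> (v \<in> {a, b} \<or> u \<in> {a, b})" if "v \<in> verts G" for u v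
    using nbrs_subset[OF G, of v] book that unfolding book_def nbrs_def by auto
  have ab: "a \<in> verts G" "b \<in> verts G" "a \<noteq> b" using book by (auto simp: book_def)
  show "nbrs G a = verts G - {a}" "nbrs G b = verts G - {b}" using iff[OF ab(1)] iff[OF ab(2)] ab by auto
  assume v: "v \<in> verts G - {a, b}"
  then have "v \<in> verts G" by simp
  from iff[OF this] v ab show "nbrs G v = {a, b}" by auto
qed

text \<open>Two vertices have degree n - 1 and the other n - 2 have degree 2. The equation later
  yields both the parity of m and the order of the split graph.\<close>

lemma book_card_edges:
  assumes G: "simple_graph G" and book: "book G a b"
  shows "card (edges G) + 3 = 2 * card (verts G)"
proof -
  have fin: "finite (verts G)" using G by (simp add: simple_graph_def)
  have ab: "a \<in> verts G" "b \<in> verts G" "a \<noteq> b" using book by (auto simp: book_def)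
  have n2: "2 \<le> card (verts G)" using card_mono[OF fin, of "{a, b}"] ab by simp
  have "(\<Sum>v\<in>verts G. card (nbrs G v)) = card (nbrs G a) + (card (nbrs G b) + (\<Sum>v\<in>verts G - {a} - {b}. card (nbrs G v)))"
    using fin ab sum.remove[of "verts G" a "\<lambda>v. card (nbrs G v)"]
      sum.remove[of "verts G - {a}" b "\<lambda>v. card (nbrs G v)"] by simp
  also have "(\<Sum>v\<in>verts G - {a} - {b}. card (nbrs G v)) = (\<Sum>v\<in>verts G - {a} - {b}. 2)"
    using nbrs_book(3)[OF G book] ab by (intro sum.cong) auto
  finally have "2 * card (edges G) = (card (verts G) - 1) + (card (verts G) - 1) + (card (verts G) - 2) * 2"
    using handshaking[OF G] nbrs_book(1,2)[OF G book] fin ab by simp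
  then show ?thesis using n2 by linarith
qed

text \<open>With s the weight of the spine and t that of the pages, l s = s + 2 t and l t = (n - 2)
  s, hence l^2 - l = m - 1. Working with the sum s avoids proving x a = x b.\<close>

lemma spectral_radius_book:
  assumes G: "simple_graph G" and book: "book G a b" and m: "1 < card (edges G)"
  shows "graph_spectral_radius G = (1 + sqrt (4 * real (card (edges G)) - 3)) / 2"
proof -
  define l where "l = graph_spectral_radius G"
  define V where "V = verts G"
  have fin: "finite V" using G by (simp add: simple_graph_def V_def)
  have ab: "a \<in> V" "b \<in> V" "a \<noteq> b" using book by (auto simp: book_def V_def)
  obtain x where x0: "\<And>v. v \<in> V \<Longrightarrow> 0 \<le> x v" and ex: "\<exists>v\<in>V. 0 < x v"
    and eig: "\<And>v. v \<in> V \<Longrightarrow> l * x v = sum x (nbrs G v)"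
    using perron_vector[OF G] ab(1) unfolding l_def V_def by (metis empty_iff)
  define L where "L = V - {a, b}"
  define t where "t = sum x L"
  define s where "s = x a + x b"
  have L: "V - {a} = insert b L" "V - {b} = insert a L" "finite L" "a \<notin> L" "b \<notin> L"
    using ab fin by (auto simp: L_def)
  have 1: "l * x a = x b + t" "l * x b = x a + t"
    using eig[OF ab(1)] eig[OF ab(2)] nbrs_book(1,2)[OF G book] L by (simp_all add: V_def[symmetric] t_def)
  have "l * x v = s" if "v \<in> L" for v
    using eig[of v] nbrs_book(3)[OF G book, of v] that ab by (simp add: L_def V_def s_def)
  then have 2: "l * t = real (card L) * s" by (simp add: t_def sum_distrib_left)
  have t0: "0 \<le> t" unfolding t_def using x0 by (intro sum_nonneg) (auto simp: L_def)
  have s_pos: "0 < s"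
  proof (rule ccontr)
    assume "\<not> ?thesis"
    then have "x a = 0" "x b = 0" using x0[OF ab(1)] x0[OF ab(2)] by (auto simp: s_def)
    moreover from this have "t = 0" using 1 by simp
    then have "\<forall>v\<in>L. x v = 0"
      unfolding t_def using L(3) x0 by (subst (asm) sum_nonneg_eq_0_iff) (auto simp: L_def)
    ultimately have "\<forall>v\<in>V. x v = 0" by (auto simp: L_def)
    then show False using ex by auto
  qed
  have "l\<^sup>2 * s = l * (l * x a + l * x b)" by (simp add: s_def power2_eq_square algebra_simps)
  also have "\<dots> = l * s + 2 * (l * t)" unfolding 1 by (simp add: s_def algebra_simps)
  finally have "(l\<^sup>2 - l - 2 * card L) * s = 0" unfolding 2 by (simp add: algebra_simps)
  then have "l\<^sup>2 - l = 2 * real (card L)" using s_pos by simp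
  moreover have "card (edges G) = 2 * card L + 1"
  proof -
    have "card V = card L + 2" using ab L fin card_Suc_Diff1[of V a] card_Suc_Diff1[of "V - {a}" b] by simp
    then show ?thesis using book_card_edges[OF G book] by (simp add: V_def)
  qed
  ultimately have q: "l\<^sup>2 - l = real (card (edges G)) - 1" by simp
  have "0 \<le> l"
  proof -
    have "0 \<le> l * s" using 1 t0 x0[OF ab(1)] x0[OF ab(2)] by (simp add: s_def distrib_left)
    then show ?thesis using s_pos by (simp add: zero_le_mult_iff)
  qed
  \<comment> \<open>m > 1 rules out the smaller root and fixes the sign of 2 l - 1.\<close>
  moreover have "0 < l * (l - 1)" using q m by (simp add: power2_eq_square algebra_simps)
  ultimately have "1 < l" by (simp add: zero_less_mult_iff)
  have "(2 * l - 1)\<^sup>2 = 4 * (l\<^sup>2 - l) + 1" by (simp add: power2_eq_square algebra_simps)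
  then have "(2 * l - 1)\<^sup>2 = 4 * real (card (edges G)) - 3" using q by simp
  then have "sqrt (4 * real (card (edges G)) - 3) = 2 * l - 1"
    using \<open>1 < l\<close> by (intro real_sqrt_unique) auto
  then show ?thesis by (simp add: l_def)
qed

section \<open>From the star in G[N] to the theorem\<close>

lemma (in perron_graph) perron_graph_star_book:
  assumes "\<And>v. A v = nbrs G v" and V: "V = verts G"
    and star: "\<exists>p\<in>N. V = insert u0 N \<and> nN p = N - {p} \<and> (\<forall>u\<in>N - {p}. nN u = {p})"
  shows "\<exists>a b. book G a b"
proof -
  obtain p where "p \<in> N" and "V = insert u0 N \<and> nN p = N - {p} \<and> (\<forall>u\<in>N - {p}. nN u = {p})"
    using star by (rule bexE)
  then have p: "p \<in> N" "V = insert u0 N" "nN p = N - {p}" "\<And>u. u \<in> N - {p} \<Longrightarrow> nN u = {p}" by simp_all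
  have edge: "{u, v} \<in> edges G \<longleftrightarrow> v \<in> A u" for u v using assms(1) by (simp add: nbrs_def)
  have adj: "v \<in> A u \<longleftrightarrow> u \<noteq> v \<and> (u \<in> {u0, p} \<or> v \<in> {u0, p})" if uv: "u \<in> V" "v \<in> V" for u v
  proof -
    have uv': "u \<in> insert u0 N" "v \<in> insert u0 N" using uv p(2) by simp_all
    consider "u = u0" | "v = u0" "u \<noteq> u0" | "u \<in> N" "v \<in> N" using uv' by blast
    then show ?thesis
    proof cases
      case 1
      then show ?thesis using uv' u0_N by (auto simp: N_def)
    next
      case 2
      then have "u \<in> A u0" using uv' by (simp add: N_def)
      then have "u0 \<in> A u" using A_sym by blast
      then show ?thesis using 2 by simp
    next
      case 3
      then have "v \<in> A u \<longleftrightarrow> v \<in> nN u" by simp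
      also have "\<dots> \<longleftrightarrow> u \<noteq> v \<and> (u = p \<or> v = p)"
        using 3 p(3) p(4)[of u] by (cases "u = p") auto
      finally show ?thesis using 3 u0_N by auto
    qed
  qed
  have "book G u0 p"
    unfolding book_def
  proof (intro conjI ballI)
    show "u0 \<in> verts G" "p \<in> verts G" using u0 p(1) N_sub V by auto
    show "u0 \<noteq> p" using p(1) u0_N by auto
    fix u v assume "u \<in> verts G" "v \<in> verts G"
    then show "{u, v} \<in> edges G \<longleftrightarrow> u \<noteq> v \<and> (u \<in> {u0, p} \<or> v \<in> {u0, p})"
      unfolding edge V[symmetric] by (rule adj)
  qed
  then show ?thesis by blast
qed

lemma book_if_large_spectral_radius:
  assumes G: "simple_graph G" and iso: "no_isolated_vertices G" and m: "card (edges G) = m"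
    and r: "r = 3 \<and> 8 \<le> m \<or> r = 4 \<and> 22 \<le> m"
    and free: "\<not> contains_copy G (theta_graph 1 2 r)"
    and large: "(1 + sqrt (4 * real m - 3)) / 2 \<le> graph_spectral_radius G"
  shows "\<exists>a b. book G a b"
proof -
  define l where "l = graph_spectral_radius G"
  define V where "V = verts G"
  have m8: "8 \<le> m" using r by auto
  have fin: "finite V" using G by (simp add: simple_graph_def V_def)
  have "edges G \<noteq> {}" using m m8 by auto
  then have "verts G \<noteq> {}" using G by (fastforce simp: simple_graph_def)
  then obtain x where x0: "\<And>v. v \<in> V \<Longrightarrow> 0 \<le> x v" and ex: "\<exists>v\<in>V. 0 < x v"
    and eig: "\<And>v. v \<in> V \<Longrightarrow> l * x v = sum x (nbrs G v)"
    using perron_vector[OF G] unfolding l_def V_def by metis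
  have "finite (x ` V)" "x ` V \<noteq> {}" using fin ex by auto
  then have "Max (x ` V) \<in> x ` V" by (rule Max_in)
  then obtain u0 where u0: "u0 \<in> V" "x u0 = Max (x ` V)" by (metis imageE)
  have max: "x v \<le> x u0" if "v \<in> V" for v using u0(2) fin that by simp
  have pos: "0 < x u0" using ex max by force
  define y where "y v = x v / x u0" for v
  have sq: "real m - 1 \<le> l\<^sup>2 - l"
  proof -
    have "sqrt (4 * real m - 3) \<le> 2 * l - 1" using large by (simp add: l_def)
    then have "(sqrt (4 * real m - 3))\<^sup>2 \<le> (2 * l - 1)\<^sup>2" using m8 by (intro power_mono) auto
    also have "\<dots> = 4 * (l\<^sup>2 - l) + 1" by (simp add: power2_eq_square algebra_simps)
    finally show ?thesis using m8 by simp
  qed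
  \<comment> \<open>The condition is k(k - 1) < m - 1, which puts k below the larger root of t^2 - t
    = m - 1; it is applied to k = 3 and k = 5.\<close>
  have gt: "k < l" if "4 * k * (k - 1) + 4 < 4 * real m" for k :: real
  proof -
    have "(2 * k - 1)\<^sup>2 < 4 * real m - 3" using that by (simp add: power2_eq_square algebra_simps)
    then have "2 * k - 1 < sqrt (4 * real m - 3)" by (rule real_less_rsqrt)
    then show ?thesis using large by (simp add: l_def)
  qed
  have pg: "perron_graph V (nbrs G) y l m u0"
  proof
    show "finite V" "u0 \<in> V" by fact+
    show "nbrs G v \<subseteq> V" "v \<notin> nbrs G v" for v using nbrs_subset[OF G] nbrs_irrefl[OF G] by (auto simp: V_def)
    show "u \<in> nbrs G v \<longleftrightarrow> v \<in> nbrs G u" for u v by (rule nbrs_sym)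
    show "nbrs G v \<noteq> {}" if v: "v \<in> V" for v
    proof -
      obtain e where e: "e \<in> edges G" "v \<in> e" using iso v by (auto simp: no_isolated_vertices_def V_def)
      then have "card e = 2" using G by (auto simp: simple_graph_def)
      then obtain p q where "e = {p, q}" by (auto simp: card_2_iff)
      then have "p \<in> nbrs G v \<or> q \<in> nbrs G v" using e by (auto simp: nbrs_def insert_commute)
      then show ?thesis by auto
    qed
    show "0 \<le> y v" "y v \<le> 1" if "v \<in> V" for v using that x0 max pos by (simp_all add: y_def)
    show "y u0 = 1" using pos by (simp add: y_def)
    show "l * y v = sum y (nbrs G v)" if "v \<in> V" for v
      using eig[OF that] by (simp add: y_def sum_divide_distrib[symmetric])
    show "(\<Sum>v\<in>V. card (nbrs G v)) = 2 * m" using handshaking[OF G] m by (simp add: V_def)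
    show "3 < l" using gt[of 3] m8 by simp
    show "real m - 1 \<le> l\<^sup>2 - l" by (rule sq)
  qed
  then interpret perron_graph V "nbrs G" y l m u0 .
  from r show ?thesis
  proof (elim disjE conjE)
    assume r3: "r = 3"
    interpret perron_graph_no_theta123 V "nbrs G" y l m u0
    proof
      show "7 \<le> l\<^sup>2 - l" using sq m8 by linarith
    qed (use contains_theta_1_2_3[OF G] free r3 in blast)
    show ?thesis by (rule perron_graph_star_book[OF _ V_def star_if_no_theta]) simp
  next
    assume r4: "r = 4" "22 \<le> m"
    interpret perron_graph_no_theta124 V "nbrs G" y l m u0
    proof
      show "5 < l" using gt[of 5] r4 by simp
    qed (use contains_theta_1_2_4[OF G] free r4 in blast)
    show ?thesis by (rule perron_graph_star_book[OF _ V_def star_if_no_theta]) simp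
  qed
qed

theorem theorem1p1:
  fixes G :: "'a ugraph" and r m :: nat
  assumes "r \<in> {3, 4}"
    and "m > 0"
    and "simple_graph G"
    and "card (edges G) = m"
    and "no_isolated_vertices G"
    and "\<not> contains_copy G (theta_graph 1 2 r)"
  shows "(r = 3 \<and> m \<ge> 8 \<longrightarrow>
            graph_spectral_radius G \<le> (1 + sqrt (4 * real m - 3)) / 2 \<and>
            (graph_spectral_radius G = (1 + sqrt (4 * real m - 3)) / 2 \<longleftrightarrow>
               odd m \<and> G \<cong>\<^sub>g complete_split_graph ((m + 3) div 2) 2)) \<and>
         (r = 4 \<and> m \<ge> 22 \<longrightarrow>
            graph_spectral_radius G \<le> (1 + sqrt (4 * real m - 3)) / 2 \<and>
            (graph_spectral_radius G = (1 + sqrt (4 * real m - 3)) / 2 \<longleftrightarrow>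
               odd m \<and> G \<cong>\<^sub>g complete_split_graph ((m + 3) div 2) 2))"
proof -
  let ?b = "(1 + sqrt (4 * real m - 3)) / 2"
  have "graph_spectral_radius G \<le> ?b \<and> (graph_spectral_radius G = ?b \<longleftrightarrow>
      odd m \<and> G \<cong>\<^sub>g complete_split_graph ((m + 3) div 2) 2)"
    if r: "r = 3 \<and> 8 \<le> m \<or> r = 4 \<and> 22 \<le> m"
  proof -
    have m: "1 < m" using r by auto
    have eq: "graph_spectral_radius G = ?b" if "book G a b" for a b
      using spectral_radius_book[OF assms(3) that] m assms(4) by simp
    have iso: "odd m \<and> G \<cong>\<^sub>g complete_split_graph ((m + 3) div 2) 2" if "book G a b" for a b
    proof -
      have "m + 3 = 2 * card (verts G)" using book_card_edges[OF assms(3) that] assms(4) by simp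
      then have "odd m" "(m + 3) div 2 = card (verts G)" by presburger+
      then show ?thesis using iso_split_if_book[OF _ that] assms(3) by (simp add: simple_graph_def)
    qed
    have book: "\<exists>a b. book G a b" if "?b \<le> graph_spectral_radius G"
      using book_if_large_spectral_radius[OF assms(3,5,4) r assms(6) that] .
    \<comment> \<open>At or above the bound G is a book, and a book meets it exactly; so the bound
      is never exceeded, and equality characterises books.\<close>
    show ?thesis
      using book eq iso book_if_iso_split[of G] by (metis order.refl linorder_le_cases)
  qed
  then show ?thesis by blast
qed

end
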